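(* Let $\mathcal{H}_1,\mathcal{H}_2,\mathcal{H}_3,\mathcal{H}_4$ be separable Hilbert spaces, $r\in\mathbb{N}$, $M\in L_2(\mathcal{H}_1,\mathcal{H}_4)$, $B\in\mathcal{B}(\mathcal{H}_3,\mathcal{H}_4)$, $C\in\mathcal{B}(\mathcal{H}_1,\mathcal{H}_2)$. Put $K:=P_{\overline{\operatorname{ran}B}}MP_{(\ker C)^\perp}$, suppose that the set $\mathcal{Y}_r$ defined in the context is nonempty, and let $(K)_r\in\mathcal{Y}_r$. Let $\hat X:=B^\dagger(K)_rC^\dagger:\operatorname{dom}(C^\dagger)\subset\mathcal{H}_2\to\mathcal{H}_3$ and $Z:=B^\dagger(K)_r$, so $\hat X=ZC^\dagger$. The following are equivalent: (i) $\hat X$ is bounded. (ii) $\ker\hat X$ is closed in $\operatorname{dom}(C^\dagger)$. (iii) $C(\ker Z\cap(\ker C)^\perp)$ is closed in $\operatorname{ran}C$. (iv) $\|Zh\|\le\eta\|Ch\|$ for all $h\in\mathcal{H}_1$ and some $\eta>0$. (v) $\operatorname{ran}\big((P_{\overline{\operatorname{ran}C^*}}M^*P_{(\ker B^* )^\perp})_r\big)\subset\operatorname{dom}((C^* )^\dagger)$, where $(P_{\overline{\operatorname{ran}C^*}}M^*P_{(\ker B^* )^\perp})_r$ is the rank-$r$ truncated SVD of $K^*=P_{\overline{\operatorname{ran}C^*}}M^*P_{(\ker B^* )^\perp}$ given by the adjoint of the chosen $(K)_r$.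
   Context: All Hilbert spaces are over a common field $\mathbb{R}$ or $\mathbb{C}$ and may be finite- or infinite-dimensional. A linear operator is a linear map on a linear subspace $\operatorname{dom}(\cdot)$, possibly unbounded. $\mathcal{B}(\mathcal{H},\mathcal{K})$ denotes the bounded everywhere-defined operators, $L_2(\mathcal{H},\mathcal{K})$ the Hilbert--Schmidt operators with norm $\|\cdot\|_{L_2}$, and $\mathcal{B}_{00,r}(\mathcal{H},\mathcal{K})$ the bounded operators with range of dimension at most $r$. $P_V$ is the orthogonal projector onto a closed subspace $V$. Moore--Penrose inverse: for $T\in\mathcal{B}(\mathcal{H},\mathcal{K})$, $\operatorname{dom}(T^\dagger)=\operatorname{ran}T\oplus(\operatorname{ran}T)^\perp$ and $T^\dagger(h+k)=(T|_{(\ker T)^\perp})^{-1}h$ for $h\in\operatorname{ran}T$, $k\in(\operatorname{ran}T)^\perp$. A rank-$r$ truncated SVD $(T)_r$ of a compact operator $T=\sum_i\sigma_i\langle\cdot,e_i\rangle f_i$ (nonincreasing singular values) keeps the first $r$ terms; it is not unique in general. $\mathcal{Y}_r=\{Y\in\mathcal{B}_{00,r}(\mathcal{H}_1,\mathcal{H}_4):\ \operatorname{ran}Y\subset\operatorname{dom}(B^\dagger),\ \|K-Y\|_{L_2}\le\|K-\tilde Y\|_{L_2}\ \forall\,\tilde Y\in\mathcal{B}_{00,r}(\mathcal{H}_1,\mathcal{H}_4)\}$; it consists of the rank-$r$ truncated SVDs of $K$ that map into $\operatorname{dom}(B^\dagger)$. *)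

theory Defs
  imports "HOL-Analysis.Analysis"
begin

section \<open>Scalars: the reals or the complex numbers\<close>

text \<open>
  The last axiom pins down the conjugation (\<open>scnj x = \<bar>x\<bar>\<^sup>2 / x\<close> for \<open>x \<noteq> 0\<close>), so there
  is no freedom in its choice.  As a real normed field is isometrically isomorphic to the field of
  real or of complex numbers, these two are the only instances up to isomorphism.
\<close>

class rc_scalar = real_normed_field +
  fixes scnj :: "'a \<Rightarrow> 'a"
  assumes scnj_add: "scnj (x + y) = scnj x + scnj y"
    and scnj_mult: "scnj (x * y) = scnj x * scnj y"
    and mult_scnj: "x * scnj x = ((norm x)\<^sup>2) *\<^sub>R 1"

instantiation real :: rc_scalar
begin
definition scnj_real :: "real \<Rightarrow> real" where "scnj_real x = x"
instance
  by standard (simp_all add: scnj_real_def power2_eq_square)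
end

instantiation complex :: rc_scalar
begin
definition scnj_complex :: "complex \<Rightarrow> complex" where "scnj_complex = cnj"
instance
  by standard (simp_all add: scnj_complex_def complex_mult_cnj cmod_power2 scaleR_conv_of_real)
end

section \<open>Hilbert spaces\<close>

text \<open>
  A Hilbert space over \<open>'k\<close> is a whole type \<open>'a\<close> of class \<^class>\<open>banach\<close>, which supplies addition, real
  scaling, norm, topology and completeness, together with a \<open>'k\<close>-scaling and a \<open>'k\<close>-valued inner
  product (linear in the first argument) that are compatible with them.
\<close>

record ('k, 'a) hilbert =
  smult :: "'k \<Rightarrow> 'a \<Rightarrow> 'a"
  ip :: "'a \<Rightarrow> 'a \<Rightarrow> 'k"

locale hilbert_space =
  fixes H :: "('k::rc_scalar, 'a::banach) hilbert"
  assumes vector_space_smult: "vector_space (smult H)"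
    and smult_of_real: "smult H (of_real c) x = c *\<^sub>R x"
    and ip_add_left: "ip H (x + y) z = ip H x z + ip H y z"
    and ip_smult_left: "ip H (smult H a x) z = a * ip H x z"
    and ip_scnj: "ip H y x = scnj (ip H x y)"
    and ip_self: "ip H x x = of_real ((norm x)\<^sup>2)"

locale separable_hilbert_space = hilbert_space H
  for H :: "('k::rc_scalar, 'a::banach) hilbert" +
  assumes separable: "separable_space (euclidean :: 'a topology)"

lemma hilbert_space_real_inner:
  "hilbert_space \<lparr>smult = scaleR, ip = (inner :: 'a::{real_inner, banach} \<Rightarrow> 'a \<Rightarrow> real)\<rparr>"
  by unfold_locales
    (simp_all add: algebra_simps inner_commute scnj_real_def power2_norm_eq_inner)

lemma hilbert_space_complex:
  "hilbert_space \<lparr>smult = (*), ip = (\<lambda>x y :: complex. x * cnj y)\<rparr>"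
  by unfold_locales
    (simp_all add: algebra_simps scnj_complex_def complex_mult_cnj cmod_power2 scaleR_conv_of_real)

definition orth :: "('k::rc_scalar, 'a::banach) hilbert \<Rightarrow> 'a set \<Rightarrow> 'a set"
  where "orth H S = {x. \<forall>y\<in>S. ip H x y = 0}"

definition proj :: "('k::rc_scalar, 'a::banach) hilbert \<Rightarrow> 'a set \<Rightarrow> 'a \<Rightarrow> 'a"
  where "proj H V x = (THE p. p \<in> V \<and> x - p \<in> orth H V)"

definition orthonormal :: "('k::rc_scalar, 'a::banach) hilbert \<Rightarrow> 'a set \<Rightarrow> bool"
  where "orthonormal H E \<longleftrightarrow> (\<forall>x\<in>E. \<forall>y\<in>E. ip H x y = (if x = y then 1 else 0))"

definition is_onb :: "('k::rc_scalar, 'a::banach) hilbert \<Rightarrow> 'a set \<Rightarrow> bool"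
  where "is_onb H E \<longleftrightarrow> orthonormal H E \<and> closure (module.span (smult H) E) = UNIV"

definition some_onb :: "('k::rc_scalar, 'a::banach) hilbert \<Rightarrow> 'a set"
  where "some_onb H = (SOME E. is_onb H E)"

section \<open>Operators\<close>

definition ker_op :: "('a \<Rightarrow> 'b::zero) \<Rightarrow> 'a set"
  where "ker_op T = {x. T x = 0}"

definition bounded_ops ::
  "('k::rc_scalar, 'a::banach) hilbert \<Rightarrow> ('k, 'b::banach) hilbert \<Rightarrow> ('a \<Rightarrow> 'b) set"
  where "bounded_ops H K =
    {T. Vector_Spaces.linear (smult H) (smult K) T \<and> (\<exists>c. \<forall>x. norm (T x) \<le> c * norm x)}"

definition adj ::
  "('k::rc_scalar, 'a::banach) hilbert \<Rightarrow> ('k, 'b::banach) hilbert \<Rightarrow> ('a \<Rightarrow> 'b) \<Rightarrow> ('b \<Rightarrow> 'a)"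
  where "adj H K T = (THE S. \<forall>x y. ip K (T x) y = ip H x (S y))"

text \<open>
  Square-summability and the norm do not depend on the orthonormal basis.
\<close>

definition hs_ops ::
  "('k::rc_scalar, 'a::banach) hilbert \<Rightarrow> ('k, 'b::banach) hilbert \<Rightarrow> ('a \<Rightarrow> 'b) set"
  where "hs_ops H K =
    {T \<in> bounded_ops H K. (\<lambda>e. (norm (T e))\<^sup>2) summable_on some_onb H}"

definition hs_norm :: "('k::rc_scalar, 'a::banach) hilbert \<Rightarrow> ('a \<Rightarrow> 'b::banach) \<Rightarrow> real"
  where "hs_norm H T = sqrt (\<Sum>\<^sub>\<infinity>e\<in>some_onb H. (norm (T e))\<^sup>2)"

text \<open>
  Finite dimensionality of the range is required separately, since \<^const>\<open>vector_space.dim\<close> is \<open>0\<close> on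
  infinite-dimensional spaces.
\<close>

definition rank_le_ops ::
  "('k::rc_scalar, 'a::banach) hilbert \<Rightarrow> ('k, 'b::banach) hilbert \<Rightarrow> nat \<Rightarrow> ('a \<Rightarrow> 'b) set"
  where "rank_le_ops H K r =
    {T \<in> bounded_ops H K.
      (\<exists>b. finite b \<and> range T \<subseteq> module.span (smult K) b) \<and>
      vector_space.dim (smult K) (range T) \<le> r}"

text \<open>
  A singular value decomposition \<open>T = (\<Sum>i. \<sigma> i \<langle>\<cdot>, e i\<rangle> f i)\<close> with nonincreasing singular values,
  indexed by all natural numbers: \<open>\<sigma>\<close> is padded with zeros if \<open>T\<close> has finite rank, and \<open>e\<close>, \<open>f\<close> are
  orthonormal families on the indices with \<open>\<sigma> i \<noteq> 0\<close>.  The requirement \<open>\<sigma> \<longlonglongrightarrow> 0\<close> is the compactness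
  of \<open>T\<close>; it also makes \<open>\<sigma>\<close> nonnegative.
\<close>

definition is_svd ::
  "('k::rc_scalar, 'a::banach) hilbert \<Rightarrow> ('k, 'b::banach) hilbert \<Rightarrow> ('a \<Rightarrow> 'b) \<Rightarrow>
    (nat \<Rightarrow> real) \<Rightarrow> (nat \<Rightarrow> 'a) \<Rightarrow> (nat \<Rightarrow> 'b) \<Rightarrow> bool"
  where "is_svd H K T \<sigma> e f \<longleftrightarrow>
    decseq \<sigma> \<and> \<sigma> \<longlonglongrightarrow> 0 \<and>
    inj_on e {i. \<sigma> i \<noteq> 0} \<and> orthonormal H (e ` {i. \<sigma> i \<noteq> 0}) \<and>
    inj_on f {i. \<sigma> i \<noteq> 0} \<and> orthonormal K (f ` {i. \<sigma> i \<noteq> 0}) \<and>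
    (\<forall>x. (\<lambda>i. smult K (of_real (\<sigma> i) * ip H x (e i)) (f i)) sums T x)"

definition is_truncated_svd ::
  "('k::rc_scalar, 'a::banach) hilbert \<Rightarrow> ('k, 'b::banach) hilbert \<Rightarrow> nat \<Rightarrow>
    ('a \<Rightarrow> 'b) \<Rightarrow> ('a \<Rightarrow> 'b) \<Rightarrow> bool"
  where "is_truncated_svd H K r T Y \<longleftrightarrow>
    (\<exists>\<sigma> e f. is_svd H K T \<sigma> e f \<and>
      Y = (\<lambda>x. \<Sum>i<r. smult K (of_real (\<sigma> i) * ip H x (e i)) (f i)))"

section \<open>The Moore--Penrose inverse and unbounded operators\<close>

text \<open>
  A partially defined operator is represented by a domain and a function on the whole type whose
  values outside the domain are irrelevant.
\<close>

definition mp_dom :: "('k::rc_scalar, 'b::banach) hilbert \<Rightarrow> ('a \<Rightarrow> 'b) \<Rightarrow> 'b set"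
  where "mp_dom K T = {h + k | h k. h \<in> range T \<and> k \<in> orth K (range T)}"

text \<open>The inner description selects the component \<open>h\<close> of \<open>y = h + k\<close>.\<close>

definition mp_inv ::
  "('k::rc_scalar, 'a::banach) hilbert \<Rightarrow> ('k, 'b::banach) hilbert \<Rightarrow> ('a \<Rightarrow> 'b) \<Rightarrow> 'b \<Rightarrow> 'a"
  where "mp_inv H K T y =
    the_inv_into (orth H (ker_op T)) T (THE h. h \<in> range T \<and> y - h \<in> orth K (range T))"

definition bounded_op_on :: "'a::real_normed_vector set \<Rightarrow> ('a \<Rightarrow> 'b::real_normed_vector) \<Rightarrow> bool"
  where "bounded_op_on D X \<longleftrightarrow> (\<exists>c. \<forall>x\<in>D. norm (X x) \<le> c * norm x)"

definition ker_on :: "'a set \<Rightarrow> ('a \<Rightarrow> 'b::zero) \<Rightarrow> 'a set"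
  where "ker_on D X = {x \<in> D. X x = 0}"

text \<open>The set \<open>\<Y>\<^sub>r\<close> of best rank-\<open>r\<close> approximations of \<open>T\<close> that map into the domain of \<open>B\<^sup>\<dagger>\<close>.\<close>

definition best_approx_set ::
  "('k::rc_scalar, 'a::banach) hilbert \<Rightarrow> ('k, 'd::banach) hilbert \<Rightarrow> nat \<Rightarrow>
    ('c \<Rightarrow> 'd) \<Rightarrow> ('a \<Rightarrow> 'd) \<Rightarrow> ('a \<Rightarrow> 'd) set"
  where "best_approx_set H K r B T =
    {Y \<in> rank_le_ops H K r. range Y \<subseteq> mp_dom K B \<and>
      (\<forall>Y'\<in>rank_le_ops H K r. hs_norm H (\<lambda>x. T x - Y x) \<le> hs_norm H (\<lambda>x. T x - Y' x))}"

end

theory Submission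
  imports Defs
begin

text \<open>
  Let \<open>R\<close> be the range of the minimizer \<open>Y = (K)\<^sub>r\<close>.  By Pythagoras, \<open>Y = P\<^sub>R K\<close>, and \<open>R\<close> maximizes the
  trace of \<open>K K\<^sup>*\<close> over the subspaces of dimension at most \<open>r\<close>.  Varying one basis vector of \<open>R\<close> shows
  that \<open>K\<^sup>*\<close> maps \<open>R\<close> and its orthogonal complement to orthogonal subspaces and is larger on the unit
  sphere of \<open>R\<close>.  A singular value decomposition of \<open>K\<^sup>*\<close> is therefore obtained by appending one of
  \<open>K\<^sup>* (1 - P\<^sub>R)\<close> to one of \<open>K\<^sup>* P\<^sub>R = Y\<^sup>*\<close>.  For the equivalences, \<open>Xhat (C h + k) = Z h\<close> for \<open>k\<close>
  orthogonal to \<open>range C\<close>, and \<open>Z\<close> has finite rank; (iv) says that \<open>h \<mapsto> \<langle>Y h, y\<rangle> = \<langle>B Z h, y\<rangle>\<close> is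
  dominated by \<open>\<parallel>C h\<parallel>\<close>, so that it is \<open>\<langle>C h, w\<rangle>\<close> for some \<open>w\<close>, whence \<open>Y\<^sup>* y = C\<^sup>* w\<close>.
\<close>

section \<open>Scalars\<close>

text \<open>The hypothesis on \<open>Y\<close> is minimality of a norm, whereas the claim about
  \<open>Kstar\<close> asks for a complete singular value decomposition whose first \<open>r\<close>
  terms give the adjoint of \<open>Y\<close>. With repeated singular values such decompositions are
  not unique, so one has to be built around the given \<open>Y\<close>. The variation takes place on
  the range side, where finite orthonormal bases are at hand, and therefore speaks about the adjoint
  of \<open>K\<close>. Two places are delicate. If the range has dimension below \<open>r\<close>,
  enlarging the basis replaces exchanging a vector. Where the two decompositions are glued, the last
  value of the first must dominate the first value of the second. In the equivalences the obstacle
  is that the domain of the Moore-Penrose inverse of \<open>B\<close> contains the whole orthogonal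
  complement of \<open>range B\<close>, where the inverse is 0. So \<open>B (Z x) = Y x\<close> does
  not follow from the domain condition alone; it is obtained from the inclusion of
  \<open>range Y\<close> in \<open>range K\<close>.\<close>

lemma scnj_0 [simp]: "scnj (0::'k::rc_scalar) = 0"
  using scnj_add[of 0 "0::'k"] by simp

lemma scnj_minus [simp]: "scnj (- x) = - scnj (x::'k::rc_scalar)"
  using scnj_add[of x "- x"] by (simp add: eq_neg_iff_add_eq_0 add.commute)

lemma scnj_diff: "scnj (x - y) = scnj x - scnj (y::'k::rc_scalar)"
  using scnj_add[of x "- y"] by simp

lemma scnj_sum: "scnj (sum f A) = (\<Sum>x\<in>A. scnj (f x :: 'k::rc_scalar))"
  by (induction A rule: infinite_finite_induct) (simp_all add: scnj_add)

lemma mult_scnj_of_real: "x * scnj x = of_real ((norm x)\<^sup>2)" for x :: "'k::rc_scalar"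
  by (simp add: mult_scnj of_real_def)

lemma scnj_of_real [simp]: "scnj (of_real c) = (of_real c :: 'k::rc_scalar)"
  using mult_scnj_of_real[of "of_real c :: 'k"]
  by (cases "c = 0") (auto simp: power2_eq_square)

lemma norm_scnj [simp]: "norm (scnj x) = norm (x::'k::rc_scalar)"
proof -
  have "norm x * norm (scnj x) = norm x * norm x"
    using arg_cong[OF mult_scnj_of_real[of x], of norm]
    by (simp add: norm_mult power2_eq_square)
  then show ?thesis by (cases "x = 0") auto
qed

lemma scnj_scnj [simp]: "scnj (scnj x) = (x::'k::rc_scalar)"
proof (cases "x = 0")
  case False
  have "scnj x * scnj (scnj x) = scnj x * x"
    using mult_scnj_of_real[of x] mult_scnj_of_real[of "scnj x"] by (simp add: mult.commute)
  moreover have "scnj x \<noteq> 0"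
    using False norm_scnj[of x] by (metis norm_eq_zero)
  ultimately show ?thesis by simp
qed simp

lemma scnj_eq_0_iff [simp]: "scnj x = 0 \<longleftrightarrow> x = (0::'k::rc_scalar)"
  using norm_scnj[of x] by (metis norm_eq_zero)

text \<open>For a fixed point \<open>y * scnj y\<close> is the square of \<open>y\<close>, so the
  difference of the squares of \<open>y\<close> and of its norm vanishes and factors in the
  field.\<close>

lemma scnj_fixed_real:
  assumes "scnj y = (y::'k::rc_scalar)"
  shows "\<exists>a. y = of_real a \<and> \<bar>a\<bar> = norm y"
proof -
  have "(y - of_real (norm y)) * (y + of_real (norm y)) = 0"
    using mult_scnj_of_real[of y] assms by (simp add: algebra_simps power2_eq_square)
  then have "y = of_real (norm y) \<or> y = of_real (- norm y)"
    by (auto simp: eq_neg_iff_add_eq_0)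
  then show ?thesis
  proof
    assume "y = of_real (norm y)"
    then show ?thesis by (intro exI[of _ "norm y"]) simp
  next
    assume "y = of_real (- norm y)"
    then show ?thesis by (intro exI[of _ "- norm y"]) simp
  qed
qed

text \<open>The scalars have real dimension at most two: they are spanned by \<open>1\<close> and, unless
  \<open>scnj\<close> is the identity, any nonzero \<open>j\<close> with \<open>scnj j = - j\<close>.\<close>

lemma compact_cball_scalar: "compact (cball (0::'k::rc_scalar) R)"
proof -
  obtain j :: 'k where j: "\<And>x. \<exists>b. x - scnj x = of_real b * j \<and> \<bar>b\<bar> * norm j \<le> 2 * norm x"
  proof (cases "\<forall>x::'k. scnj x = x")
    case True
    then show ?thesis by (intro that[of 0]) auto
  next
    case False
    then obtain z :: 'k where z: "scnj z \<noteq> z" by blast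
    define j where "j = z - scnj z"
    have j: "j \<noteq> 0" "scnj j = - j" using z by (auto simp: j_def scnj_diff)
    show ?thesis
    proof (rule that[of j])
      fix x :: 'k
      \<comment> \<open>Conjugation changes the sign of both \<open>x - scnj x\<close> and
        \<open>j\<close>, so their quotient is fixed and hence real.\<close>
      have "scnj ((x - scnj x) / j) * scnj j = scnj (x - scnj x)"
        using j(1) by (simp flip: scnj_mult)
      then have "scnj ((x - scnj x) / j) = (x - scnj x) / j"
        using j by (simp add: scnj_diff nonzero_eq_divide_eq algebra_simps)
      then obtain b where b: "(x - scnj x) / j = of_real b"
        using scnj_fixed_real by blast
      then have eq: "x - scnj x = of_real b * j"
        using j(1) by (simp add: nonzero_divide_eq_eq)
      then have "\<bar>b\<bar> * norm j = norm (x - scnj x)"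
        by (simp add: norm_mult)
      also have "\<dots> \<le> 2 * norm x"
        using norm_triangle_ineq4[of x "scnj x"] by simp
      finally show "\<exists>b. x - scnj x = of_real b * j \<and> \<bar>b\<bar> * norm j \<le> 2 * norm x"
        using eq by blast
    qed
  qed
  define g :: "real \<times> real \<Rightarrow> 'k" where "g = (\<lambda>(a, b). of_real a + of_real b * j)"
  define s where "s = (if j = 0 then 0 else R / norm j)"
  have "cball 0 R \<subseteq> g ` ({-R..R} \<times> {-s..s})"
  proof
    fix x :: 'k assume "x \<in> cball 0 R"
    then have x: "norm x \<le> R" by simp
    have "scnj (x + scnj x) = x + scnj x" by (simp add: scnj_add)
    then obtain a where a: "x + scnj x = of_real a" "\<bar>a\<bar> = norm (x + scnj x)"
      using scnj_fixed_real by blast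
    have a2: "\<bar>a\<bar> \<le> 2 * R"
      using a(2) norm_triangle_ineq[of x "scnj x"] x by simp
    obtain b where b: "x - scnj x = of_real b * j" "\<bar>b\<bar> * norm j \<le> 2 * norm x"
      using j by blast
    \<comment> \<open>The half comes from \<open>2 * x = (x + scnj x) + (x - scnj x)\<close>. For
      \<open>j = 0\<close> the coefficient \<open>b\<close> is unconstrained and is replaced by 0 to
      stay in the rectangle.\<close>
    define b' where "b' = (if j = 0 then 0 else b / 2)"
    have "2 * x = of_real a + of_real b * j"
      using a(1) b(1) by (simp flip: a(1) b(1))
    then have "x = (of_real a + of_real b * j) / 2" by (simp add: field_simps)
    then have "x = g (a / 2, b')"
      by (auto simp: g_def b'_def add_divide_distrib)
    moreover have "\<bar>b'\<bar> \<le> s"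
    proof (cases "j = 0")
      case False
      then have "\<bar>b\<bar> * norm j \<le> 2 * R" using b(2) x by linarith
      then have "\<bar>b\<bar> \<le> 2 * R / norm j"
        using False by (simp add: pos_le_divide_eq)
      then show ?thesis using False by (simp add: b'_def s_def mult.commute)
    qed (simp add: b'_def s_def)
    ultimately show "x \<in> g ` ({-R..R} \<times> {-s..s})"
      using a2 by (intro image_eqI[of _ _ "(a / 2, b')"]) (auto simp: abs_le_iff)
  qed
  moreover have "compact (g ` ({-R..R} \<times> {-s..s}))"
    unfolding g_def case_prod_beta
    by (intro compact_continuous_image compact_Times continuous_intros) auto
  ultimately show ?thesis
    using compact_Int_closed[OF _ closed_cball[of "0::'k" R]] by (metis inf.absorb_iff2)
qed

section \<open>Hilbert spaces\<close>

sublocale hilbert_space \<subseteq> vs: vector_space "smult H"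
  by (rule vector_space_smult)

context hilbert_space
begin

lemma ip_zero_left [simp]: "ip H 0 z = 0"
  using ip_add_left[of 0 0 z] by simp

lemma ip_zero_right [simp]: "ip H z 0 = 0"
  using ip_scnj[of z 0] by simp

lemma ip_minus_left: "ip H (- x) z = - ip H x z"
  using ip_add_left[of x "- x" z] by (simp add: eq_neg_iff_add_eq_0 add.commute)

lemma ip_diff_left: "ip H (x - y) z = ip H x z - ip H y z"
  using ip_add_left[of x "- y" z] by (simp add: ip_minus_left)

lemma ip_sum_left: "ip H (sum f A) z = (\<Sum>a\<in>A. ip H (f a) z)"
  by (induction A rule: infinite_finite_induct) (simp_all add: ip_add_left)

lemma ip_add_right: "ip H z (x + y) = ip H z x + ip H z y"
  by (simp add: ip_scnj[of z] ip_add_left scnj_add)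

lemma ip_diff_right: "ip H z (x - y) = ip H z x - ip H z y"
  by (simp add: ip_scnj[of z] ip_diff_left scnj_diff)

lemma ip_sum_right: "ip H z (sum f A) = (\<Sum>a\<in>A. ip H z (f a))"
  by (simp add: ip_scnj[of z] ip_sum_left scnj_sum)

lemma ip_smult_right: "ip H x (smult H a y) = scnj a * ip H x y"
  using ip_scnj[of x "smult H a y"] ip_scnj[of y x] by (simp add: ip_smult_left scnj_mult)

lemmas ip_simps = ip_add_left ip_diff_left ip_smult_left ip_sum_left
  ip_add_right ip_diff_right ip_smult_right ip_sum_right ip_minus_left

lemma ip_eq_0_commute: "ip H x y = 0 \<longleftrightarrow> ip H y x = 0"
  by (metis ip_scnj scnj_eq_0_iff)

lemma norm_ip_commute: "norm (ip H x y) = norm (ip H y x)"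
  by (metis ip_scnj norm_scnj)

lemma ip_self_eq_0 [simp]: "ip H x x = 0 \<longleftrightarrow> x = 0"
  by (simp add: ip_self)

lemma eqI_ip: "(\<And>z. ip H x z = ip H y z) \<Longrightarrow> x = y"
  by (metis eq_iff_diff_eq_0 ip_diff_left ip_self_eq_0)

lemma norm_smult: "norm (smult H a x) = norm a * norm x"
proof -
  have "of_real ((norm (smult H a x))\<^sup>2) = (a * scnj a) * ip H x x"
    unfolding ip_self[symmetric] by (simp add: ip_simps)
  also have "\<dots> = of_real ((norm a * norm x)\<^sup>2)"
    by (simp add: mult_scnj_of_real ip_self power_mult_distrib)
  finally have "(norm (smult H a x))\<^sup>2 = (norm a * norm x)\<^sup>2"
    using of_real_eq_iff by blast
  then show ?thesis by simp
qed

lemma pythagoras: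
  assumes "ip H x y = 0"
  shows "(norm (x + y))\<^sup>2 = (norm x)\<^sup>2 + (norm y)\<^sup>2"
proof -
  have "of_real ((norm (x + y))\<^sup>2) = ip H (x + y) (x + y)"
    by (simp add: ip_self)
  also have "\<dots> = of_real ((norm x)\<^sup>2 + (norm y)\<^sup>2)"
    unfolding ip_add_left ip_add_right
    using assms ip_eq_0_commute[of x y] by (simp add: ip_self)
  finally show ?thesis using of_real_eq_iff by blast
qed

text \<open>A real multiple of \<open>ip H x y\<close> as coefficient makes both cross terms real
  and equal. The expansion serves Cauchy-Schwarz and both first-order optimality conditions.\<close>

lemma norm_add_smult_ip:
  "(norm (x + smult H (of_real s * ip H x y) y))\<^sup>2 =
    (norm x)\<^sup>2 + (2 * s + s\<^sup>2 * (norm y)\<^sup>2) * (norm (ip H x y))\<^sup>2"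
proof -
  define t where "t = ip H x y"
  have yx: "ip H y x = scnj t" unfolding t_def by (rule ip_scnj)
  have tt: "t * scnj t = of_real ((norm t)\<^sup>2)" "scnj t * t = of_real ((norm t)\<^sup>2)"
    by (simp_all add: mult_scnj_of_real mult.commute)
  have "of_real ((norm (x + smult H (of_real s * t) y))\<^sup>2) =
      ip H (x + smult H (of_real s * t) y) (x + smult H (of_real s * t) y)"
    by (simp add: ip_self)
  also have "\<dots> = of_real ((norm x)\<^sup>2) + of_real s * (scnj t * t) + of_real s * (t * scnj t)
      + of_real (s\<^sup>2) * (t * scnj t) * of_real ((norm y)\<^sup>2)"
    unfolding ip_add_left ip_add_right ip_smult_left ip_smult_right
    by (simp add: ip_self yx t_def[symmetric] scnj_mult algebra_simps power2_eq_square)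
  also have "\<dots> = of_real ((norm x)\<^sup>2 + (2 * s + s\<^sup>2 * (norm y)\<^sup>2) * (norm t)\<^sup>2)"
    unfolding tt by (simp add: algebra_simps)
  finally show ?thesis unfolding t_def using of_real_eq_iff by blast
qed

lemma cauchy_schwarz: "norm (ip H x y) \<le> norm x * norm y"
proof (cases "y = 0")
  case False
  \<comment> \<open>This is the minimizer of
    \<open>2 * s + s\<^sup>2 * (norm y)\<^sup>2\<close>.\<close>
  define s where "s = - 1 / (norm y)\<^sup>2"
  have "0 \<le> (norm x)\<^sup>2 + (2 * s + s\<^sup>2 * (norm y)\<^sup>2) * (norm (ip H x y))\<^sup>2"
    using norm_add_smult_ip[of x s y] by (metis zero_le_power2)
  also have "2 * s + s\<^sup>2 * (norm y)\<^sup>2 = - 1 / (norm y)\<^sup>2"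
    using False by (simp add: s_def power2_eq_square field_simps)
  finally have "(norm (ip H x y))\<^sup>2 \<le> (norm x * norm y)\<^sup>2"
    using False by (simp add: field_simps)
  then show ?thesis by (rule power2_le_imp_le) simp
qed simp

lemma parallelogram: "(norm (x + y))\<^sup>2 + (norm (x - y :: 'a))\<^sup>2 = 2 * (norm x)\<^sup>2 + 2 * (norm y)\<^sup>2"
proof -
  have "of_real ((norm (x + y))\<^sup>2 + (norm (x - y))\<^sup>2) = ip H (x + y) (x + y) + ip H (x - y) (x - y)"
    by (simp add: ip_self)
  also have "\<dots> = of_real (2 * (norm x)\<^sup>2 + 2 * (norm y)\<^sup>2)"
    unfolding ip_add_left ip_add_right ip_diff_left ip_diff_right by (simp add: ip_self)
  finally show ?thesis using of_real_eq_iff by blast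
qed

lemma smult_scaleR: "smult H a (c *\<^sub>R x) = c *\<^sub>R smult H a x"
  by (simp flip: smult_of_real add: mult.commute)

lemma smult_scaleR_left: "smult H (c *\<^sub>R a) x = c *\<^sub>R smult H a x"
  by (simp add: scaleR_conv_of_real flip: smult_of_real)

lemma bounded_linear_ip_left: "bounded_linear (\<lambda>x. ip H x y)"
proof (rule bounded_linear_intro[where K = "norm y"])
  show "ip H (c *\<^sub>R x) y = c *\<^sub>R ip H x y" for c x
    by (simp add: ip_simps scaleR_conv_of_real flip: smult_of_real)
qed (simp_all add: ip_simps cauchy_schwarz)

lemma bounded_linear_smult_right: "bounded_linear (smult H a)"
  by (rule bounded_linear_intro[where K = "norm a"])
    (simp_all add: vs.scale_right_distrib smult_scaleR norm_smult mult.commute)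

lemma bounded_linear_smult_left: "bounded_linear (\<lambda>a. smult H a x)"
  by (rule bounded_linear_intro[where K = "norm x"])
    (simp_all add: vs.scale_left_distrib smult_scaleR_left norm_smult)

subsection \<open>Orthogonal complements and projections\<close>

lemma subspace_orth: "vs.subspace (orth H S)"
  by (auto simp: vs.subspace_def orth_def ip_simps)

lemma orth_altdef: "orth H S = (\<Inter>y\<in>S. {x. ip H x y = 0})"
  by (auto simp: orth_def)

lemma closed_orth: "closed (orth H S)"
  unfolding orth_altdef
proof (intro closed_INT ballI closed_Collect_eq)
  fix y show "continuous_on UNIV (\<lambda>x. ip H x y)"
    by (intro linear_continuous_on bounded_linear_ip_left)
qed auto

lemma orth_antimono: "S \<subseteq> T \<Longrightarrow> orth H T \<subseteq> orth H S"
  by (auto simp: orth_def)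

lemma orth_iff_subset: "S \<subseteq> orth H T \<longleftrightarrow> T \<subseteq> orth H S"
  using ip_eq_0_commute by (auto simp: orth_def)

lemma orth_span: "orth H (vs.span S) = orth H S"
proof
  have "S \<subseteq> orth H (orth H S)" using orth_iff_subset by blast
  then have "vs.span S \<subseteq> orth H (orth H S)"
    by (rule vs.span_minimal) (rule subspace_orth)
  then show "orth H S \<subseteq> orth H (vs.span S)" using orth_iff_subset by blast
qed (auto intro!: orth_antimono vs.span_base)

lemma orth_closure: "orth H (closure S) = orth H S"
proof
  have "S \<subseteq> orth H (orth H S)" using orth_iff_subset by blast
  then have "closure S \<subseteq> orth H (orth H S)"
    by (rule closure_minimal) (rule closed_orth)
  then show "orth H S \<subseteq> orth H (closure S)" using orth_iff_subset by blast
qed (auto intro!: orth_antimono closure_subset)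

lemma orthD: "x \<in> orth H S \<Longrightarrow> y \<in> S \<Longrightarrow> ip H x y = 0"
  by (simp add: orth_def)

lemma orthD': "x \<in> orth H S \<Longrightarrow> y \<in> S \<Longrightarrow> ip H y x = 0"
  by (simp add: orth_def ip_eq_0_commute)

lemma in_orth_self: "x \<in> S \<Longrightarrow> x \<in> orth H S \<Longrightarrow> x = 0"
  by (auto simp: orth_def)

lemma subspace_closure:
  assumes "vs.subspace S"
  shows "vs.subspace (closure S)"
proof -
  have "x + y \<in> closure S" if "x \<in> closure S" "y \<in> closure S" for x y
  proof -
    from that obtain f g where "\<And>n. f n \<in> S" "f \<longlonglongrightarrow> x" "\<And>n. g n \<in> S" "g \<longlonglongrightarrow> y"
      unfolding closure_sequential by blast
    then show ?thesis unfolding closure_sequential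
      by (intro exI[of _ "\<lambda>n. f n + g n"]) (auto intro!: tendsto_add vs.subspace_add[OF assms])
  qed
  moreover have "smult H c x \<in> closure S" if "x \<in> closure S" for c x
  proof -
    from that obtain f where "\<And>n. f n \<in> S" "f \<longlonglongrightarrow> x"
      unfolding closure_sequential by blast
    then show ?thesis unfolding closure_sequential
      by (intro exI[of _ "\<lambda>n. smult H c (f n)"])
        (auto intro!: bounded_linear.tendsto[OF bounded_linear_smult_right] vs.subspace_scale[OF assms])
  qed
  ultimately show ?thesis
    using vs.subspace_0[OF assms] closure_subset[of S] by (auto simp: vs.subspace_def)
qed

text \<open>A first-order optimality condition: a perturbation of \<open>z\<close> in the direction of \<open>y\<close> by a small
  multiple of \<open>- \<langle>z, y\<rangle>\<close> would decrease the norm.\<close>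

lemma ip_eq_0_if_minimal:
  assumes "\<And>t. (norm z)\<^sup>2 \<le> (norm (z + smult H t y))\<^sup>2"
  shows "ip H z y = 0"
proof (rule ccontr)
  assume ne: "ip H z y \<noteq> 0"
  \<comment> \<open>The added 1 keeps \<open>s * (norm y)\<^sup>2\<close> above -1, also for
    \<open>y = 0\<close>, so \<open>2 + s * (norm y)\<^sup>2\<close> stays positive.\<close>
  define s where "s = - 1 / (1 + (norm y)\<^sup>2)"
  have pos: "1 + (norm y)\<^sup>2 > 0" by (simp add: add_pos_nonneg)
  have "2 * s + s\<^sup>2 * (norm y)\<^sup>2 = s * (2 + s * (norm y)\<^sup>2)"
    by (simp add: power2_eq_square algebra_simps)
  also have "\<dots> < 0"
  proof (rule mult_neg_pos)
    show "s < 0" using pos by (simp add: s_def)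
    have "(norm y)\<^sup>2 / (1 + (norm y)\<^sup>2) < 1" using pos by (simp add: divide_less_eq)
    then show "2 + s * (norm y)\<^sup>2 > 0" by (simp add: s_def)
  qed
  finally have "(2 * s + s\<^sup>2 * (norm y)\<^sup>2) * (norm (ip H z y))\<^sup>2 < 0"
    using ne by (intro mult_neg_pos) auto
  then show False
    using assms[of "of_real s * ip H z y"] norm_add_smult_ip[of z s y] by linarith
qed

text \<open>A minimizing sequence is Cauchy by the parallelogram law, since midpoints remain in
  \<open>V\<close>. Its limit is a nearest point, and optimality gives orthogonality.\<close>

lemma ex_projection:
  assumes V: "vs.subspace V" and cl: "closed V"
  shows "\<exists>p\<in>V. x - p \<in> orth H V"
proof -
  define d where "d = (INF v\<in>V. (norm (x - v))\<^sup>2)"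
  have ne: "V \<noteq> {}" using vs.subspace_0[OF V] by auto
  have bdd: "bdd_below ((\<lambda>v. (norm (x - v))\<^sup>2) ` V)" by (rule bdd_belowI2[of _ 0]) auto
  have d: "d \<le> (norm (x - v))\<^sup>2" if "v \<in> V" for v
    unfolding d_def by (rule cINF_lower[OF bdd that])
  have "\<exists>v\<in>V. (norm (x - v))\<^sup>2 < d + 1 / Suc n" for n
    using cINF_less_iff[OF ne bdd, of "d + 1 / Suc n"] by (simp add: d_def)
  then obtain v where v: "\<And>n. v n \<in> V" "\<And>n. (norm (x - v n))\<^sup>2 < d + 1 / Suc n"
    by metis
  have close: "(norm (v m - v n))\<^sup>2 \<le> 2 / Suc m + 2 / Suc n" for m n
  proof -
    have "(1/2) *\<^sub>R (v m + v n) \<in> V"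
      using v(1) by (auto simp flip: smult_of_real intro!: vs.subspace_scale[OF V] vs.subspace_add[OF V])
    then have "4 * d \<le> 4 * (norm (x - (1/2) *\<^sub>R (v m + v n)))\<^sup>2" using d by simp
    also have "\<dots> = (norm (2 *\<^sub>R (x - (1/2) *\<^sub>R (v m + v n))))\<^sup>2"
      by (simp add: power_mult_distrib)
    also have "2 *\<^sub>R (x - (1/2) *\<^sub>R (v m + v n)) = (x - v n) + (x - v m)"
      by (simp add: scaleR_diff_right algebra_simps flip: scaleR_2)
    finally have "4 * d \<le> (norm ((x - v n) + (x - v m)))\<^sup>2" .
    moreover have "(norm ((x - v n) + (x - v m)))\<^sup>2 + (norm ((x - v n) - (x - v m)))\<^sup>2
        \<le> 2 * (d + 1 / Suc n) + 2 * (d + 1 / Suc m)"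
      unfolding parallelogram using v(2)[of m] v(2)[of n] by simp
    ultimately show ?thesis by (simp add: algebra_simps)
  qed
  have "Cauchy v"
  proof (rule metric_CauchyI)
    fix e :: real assume "e > 0"
    then obtain N where N: "inverse (real (Suc N)) < e\<^sup>2 / 4"
      using reals_Archimedean[of "e\<^sup>2 / 4"] by auto
    show "\<exists>M. \<forall>m\<ge>M. \<forall>n\<ge>M. dist (v m) (v n) < e"
    proof (intro exI allI impI)
      fix m n assume mn: "N \<le> m" "N \<le> n"
      have "1 / Suc k < e\<^sup>2 / 4" if "N \<le> k" for k
      proof -
        have "1 / Suc k \<le> inverse (real (Suc N))"
          using that by (simp add: inverse_eq_divide frac_le)
        with N show ?thesis by linarith
      qed
      from this[OF mn(1)] this[OF mn(2)] have "(norm (v m - v n))\<^sup>2 < e\<^sup>2"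
        using close[of m n] by linarith
      then show "dist (v m) (v n) < e"
        using \<open>e > 0\<close> by (simp add: dist_norm power_less_imp_less_base)
    qed
  qed
  then obtain p where p: "v \<longlonglongrightarrow> p" using Cauchy_convergent convergent_def by blast
  have pV: "p \<in> V" using closed_sequentially[OF cl] v(1) p by blast
  have "(\<lambda>n. (norm (x - v n))\<^sup>2) \<longlonglongrightarrow> (norm (x - p))\<^sup>2"
    by (intro tendsto_intros p)
  moreover have "(\<lambda>n. d + 1 / real (Suc n)) \<longlonglongrightarrow> d + 0"
    by (intro tendsto_intros LIMSEQ_Suc lim_1_over_n)
  ultimately have "(norm (x - p))\<^sup>2 \<le> d + 0"
    by (rule LIMSEQ_le) (use v(2) less_imp_le in blast)
  then have min: "(norm (x - p))\<^sup>2 \<le> (norm (x - w))\<^sup>2" if "w \<in> V" for w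
    using d[OF that] by linarith
  have "ip H (x - p) y = 0" if "y \<in> V" for y
  proof (rule ip_eq_0_if_minimal)
    fix t
    have "p - smult H t y \<in> V"
      using that pV V by (intro vs.subspace_diff vs.subspace_scale) auto
    from min[OF this] show "(norm (x - p))\<^sup>2 \<le> (norm (x - p + smult H t y))\<^sup>2"
      by (simp add: algebra_simps)
  qed
  then show ?thesis using pV by (auto simp: orth_def)
qed

text \<open>The difference \<open>p - q\<close> lies in \<open>V\<close> and in its orthogonal
  complement. The form for arbitrary subspaces lets \<open>mp_inv_eq\<close> use it for the range of
  an operator.\<close>

lemma projection_unique:
  assumes V: "vs.subspace V" and "p \<in> V" "x - p \<in> orth H V" "q \<in> V" "x - q \<in> orth H V"
  shows "p = q"
proof -
  have "(x - q) - (x - p) \<in> orth H V"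
    using vs.subspace_diff[OF subspace_orth] assms by blast
  then have "p - q \<in> orth H V" by simp
  with vs.subspace_diff[OF V, of p q] assms show ?thesis
    using in_orth_self by force
qed

lemma proj_eqI:
  assumes "vs.subspace V" and "p \<in> V" "x - p \<in> orth H V"
  shows "proj H V x = p"
  unfolding proj_def using assms projection_unique by (intro the_equality) auto

lemma
  assumes "vs.subspace V" "closed V"
  shows proj_in: "proj H V x \<in> V" and diff_proj_in: "x - proj H V x \<in> orth H V"
  using ex_projection[OF assms, of x] proj_eqI[OF assms(1)] by metis+

lemma proj_add:
  assumes "vs.subspace V" "closed V"
  shows "proj H V (x + y) = proj H V x + proj H V y"
proof (rule proj_eqI)
  have "(x - proj H V x) + (y - proj H V y) \<in> orth H V"
    using assms by (intro vs.subspace_add subspace_orth diff_proj_in)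
  then show "x + y - (proj H V x + proj H V y) \<in> orth H V" by (simp add: algebra_simps)
qed (use assms proj_in vs.subspace_add in auto)

lemma proj_smult:
  assumes "vs.subspace V" "closed V"
  shows "proj H V (smult H c x) = smult H c (proj H V x)"
proof (rule proj_eqI)
  have "smult H c (x - proj H V x) \<in> orth H V"
    using assms by (intro vs.subspace_scale subspace_orth diff_proj_in)
  then show "smult H c x - smult H c (proj H V x) \<in> orth H V" by (simp add: vs.scale_right_diff_distrib)
qed (use assms proj_in vs.subspace_scale in auto)

lemma norm_proj:
  assumes "vs.subspace V" "closed V"
  shows "(norm x)\<^sup>2 = (norm (proj H V x))\<^sup>2 + (norm (x - proj H V x))\<^sup>2"
proof -
  have "ip H (proj H V x) (x - proj H V x) = 0"
    using orthD' proj_in[OF assms] diff_proj_in[OF assms] by blast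
  from pythagoras[OF this] show ?thesis by simp
qed

lemma norm_proj_le:
  assumes "vs.subspace V" "closed V"
  shows "norm (proj H V x) \<le> norm x"
  using norm_proj[OF assms, of x] by (intro power2_le_imp_le[OF _ norm_ge_zero]) auto

lemma ip_proj_commute:
  assumes "vs.subspace V" "closed V"
  shows "ip H (proj H V x) y = ip H x (proj H V y)"
proof -
  have "ip H (proj H V x) (y - proj H V y) = 0" "ip H (x - proj H V x) (proj H V y) = 0"
    using orthD orthD' proj_in[OF assms] diff_proj_in[OF assms] by blast+
  then show ?thesis by (simp add: ip_simps)
qed

lemma orth_orth_closed:
  assumes "vs.subspace V" "closed V"
  shows "orth H (orth H V) = V"
proof
  show "orth H (orth H V) \<subseteq> V"
  proof
    fix x assume x: "x \<in> orth H (orth H V)"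
    have "proj H V x \<in> orth H (orth H V)"
      using proj_in[OF assms] orth_iff_subset by blast
    then have "x - proj H V x \<in> orth H (orth H V)"
      using vs.subspace_diff[OF subspace_orth] x by blast
    then have "x - proj H V x = 0" using diff_proj_in[OF assms] in_orth_self by blast
    then show "x \<in> V" using proj_in[OF assms, of x] by simp
  qed
qed (use orth_iff_subset in blast)

lemma orth_orth:
  assumes "vs.subspace S"
  shows "orth H (orth H S) = closure S"
  using orth_orth_closed[OF subspace_closure[OF assms] closed_closure] by (simp add: orth_closure)

end

context hilbert_space
begin

subsection \<open>Orthonormal sets\<close>

lemma orthonormal_mono: "orthonormal H F \<Longrightarrow> G \<subseteq> F \<Longrightarrow> orthonormal H G"
  unfolding orthonormal_def by blast

lemma orthonormal_norm: "orthonormal H F \<Longrightarrow> f \<in> F \<Longrightarrow> norm f = 1"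
proof -
  assume "orthonormal H F" "f \<in> F"
  then have "of_real ((norm f)\<^sup>2) = (of_real 1 :: 'k)"
    unfolding ip_self[symmetric] by (simp add: orthonormal_def)
  then have "(norm f)\<^sup>2 = 1" using of_real_eq_iff by blast
  then show ?thesis by (simp add: abs_square_eq_1)
qed

lemma ip_self_unit: "norm f = 1 \<Longrightarrow> ip H f f = 1"
  by (simp add: ip_self)

lemma orthonormal_empty [simp]: "orthonormal H {}"
  by (simp add: orthonormal_def)

lemma orthonormal_insert:
  assumes "orthonormal H F" "norm g = 1" "g \<in> orth H F"
  shows "orthonormal H (insert g F)"
  using assms orthD'[OF assms(3)] orthD[OF assms(3)] ip_self_unit[of g]
  by (auto simp: orthonormal_def)

text \<open>For finite orthonormal \<open>F\<close> this is the orthogonal projector onto the span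
  of \<open>F\<close>; the explicit sum lets operators act on it term by term.\<close>

definition fproj :: "'a set \<Rightarrow> 'a \<Rightarrow> 'a"
  where "fproj F x = (\<Sum>f\<in>F. smult H (ip H x f) f)"

lemma fproj_add: "fproj F (x + y) = fproj F x + fproj F y"
  by (simp add: fproj_def ip_simps vs.scale_left_distrib sum.distrib)

lemma fproj_smult: "fproj F (smult H c x) = smult H c (fproj F x)"
  by (simp add: fproj_def ip_simps vs.scale_sum_right)

lemma fproj_in_span: "fproj F x \<in> vs.span F"
  unfolding fproj_def by (intro vs.span_sum vs.span_scale vs.span_base)

lemma ip_fproj:
  assumes "finite F" "orthonormal H F" "f \<in> F"
  shows "ip H (fproj F x) f = ip H x f"
proof -
  have "ip H (fproj F x) f = (\<Sum>g\<in>F. ip H x g * (if g = f then 1 else 0))"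
    unfolding fproj_def ip_sum_left ip_smult_left
    using assms by (intro sum.cong) (auto simp: orthonormal_def)
  also have "\<dots> = ip H x f" using assms by (simp add: if_distrib cong: if_cong)
  finally show ?thesis .
qed

lemma diff_fproj_orth:
  assumes "finite F" "orthonormal H F"
  shows "x - fproj F x \<in> orth H F"
  using ip_fproj[OF assms] by (auto simp: orth_def ip_diff_left)

lemma fproj_eqI:
  assumes "finite F" "orthonormal H F" "p \<in> vs.span F" "x - p \<in> orth H F"
  shows "fproj F x = p"
  using projection_unique[OF vs.subspace_span fproj_in_span _ assms(3), of x]
    assms diff_fproj_orth by (simp add: orth_span)

lemma fproj_id:
  assumes "finite F" "orthonormal H F" "x \<in> vs.span F"
  shows "fproj F x = x"
  using assms by (intro fproj_eqI) (auto simp: orth_def)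

lemma norm_fproj:
  assumes "finite F" "orthonormal H F"
  shows "(norm (fproj F x))\<^sup>2 = (\<Sum>f\<in>F. (norm (ip H x f))\<^sup>2)"
proof -
  have "of_real ((norm (fproj F x))\<^sup>2) = ip H (fproj F x) (fproj F x)" by (simp add: ip_self)
  also have "\<dots> = ip H x (fproj F x)"
  proof -
    have "x - fproj F x \<in> orth H (vs.span F)"
      using diff_fproj_orth[OF assms] by (simp add: orth_span)
    from orthD[OF this fproj_in_span] show ?thesis by (simp add: ip_diff_left)
  qed
  also have "\<dots> = (\<Sum>f\<in>F. ip H x f * scnj (ip H x f))"
    unfolding fproj_def ip_sum_right ip_smult_right by (simp add: mult.commute)
  also have "\<dots> = of_real (\<Sum>f\<in>F. (norm (ip H x f))\<^sup>2)"
    by (simp add: mult_scnj_of_real)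
  finally show ?thesis using of_real_eq_iff by blast
qed

lemma norm_diff_span:
  assumes "finite F" "orthonormal H F" "y \<in> vs.span F"
  shows "(norm (x - y))\<^sup>2 = (norm (x - fproj F x))\<^sup>2 + (norm (fproj F x - y))\<^sup>2"
proof -
  have "x - fproj F x \<in> orth H (vs.span F)"
    using diff_fproj_orth[OF assms(1,2)] by (simp add: orth_span)
  then have "ip H (x - fproj F x) (fproj F x - y) = 0"
    by (rule orthD) (intro vs.span_diff fproj_in_span assms(3))
  from pythagoras[OF this] show ?thesis by simp
qed

lemma norm_fproj_decomp:
  assumes "finite F" "orthonormal H F"
  shows "(norm x)\<^sup>2 = (norm (x - fproj F x))\<^sup>2 + (\<Sum>f\<in>F. (norm (ip H x f))\<^sup>2)"
  using norm_diff_span[OF assms vs.span_zero, of x] by (simp add: norm_fproj[OF assms])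

lemma bessel:
  assumes "finite F" "orthonormal H F"
  shows "(\<Sum>f\<in>F. (norm (ip H x f))\<^sup>2) \<le> (norm x)\<^sup>2"
  using norm_fproj_decomp[OF assms, of x] by simp

lemma closed_span_orthonormal:
  assumes "finite F" "orthonormal H F"
  shows "closed (vs.span F)"
proof -
  have "vs.span F = {x. fproj F x = x}"
    using fproj_id[OF assms] fproj_in_span[of F] by (auto, metis)
  moreover have "continuous_on UNIV (fproj F)"
    unfolding fproj_def
    by (intro continuous_on_sum linear_continuous_on
        bounded_linear_compose[OF bounded_linear_smult_left bounded_linear_ip_left])
  ultimately show ?thesis by (simp add: closed_Collect_eq)
qed

lemma orthonormal_independent:
  assumes "finite F" "orthonormal H F"
  shows "vs.independent F"
proof -
  have "g f = 0" if "(\<Sum>v\<in>F. smult H (g v) v) = 0" "f \<in> F" for g f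
  proof -
    have "0 = (\<Sum>v\<in>F. g v * ip H v f)"
      using that(1) by (metis (no_types, lifting) ip_smult_left ip_sum_left ip_zero_left sum.cong)
    also have "\<dots> = (\<Sum>v\<in>F. g v * (if v = f then 1 else 0))"
      using assms that(2) by (intro sum.cong) (auto simp: orthonormal_def)
    also have "\<dots> = g f" using assms(1) that(2) by (simp add: if_distrib cong: if_cong)
    finally show ?thesis by simp
  qed
  then show ?thesis using vs.dependent_finite[OF assms(1)] by blast
qed

lemma dim_span_orthonormal:
  assumes "finite F" "orthonormal H F"
  shows "vs.dim (vs.span F) = card F"
  using orthonormal_independent[OF assms] by (rule vs.dim_span_eq_card_independent)

lemma normalize_unit:
  assumes "z \<noteq> 0"
  shows "norm (smult H (of_real (1 / norm z)) z) = 1"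
  using assms by (simp add: norm_smult norm_divide)

text \<open>Keeping \<open>S\<close> inside the result allows a prescribed unit vector to become a
  basis vector, as the exchange argument on the range of a best approximation requires.\<close>

lemma gram_schmidt:
  assumes "finite b" "finite S" "orthonormal H S"
  shows "\<exists>F. finite F \<and> orthonormal H F \<and> S \<subseteq> F \<and> vs.span F = vs.span (S \<union> b)"
  using assms(1)
proof (induction b rule: finite_induct)
  case empty
  then show ?case using assms by auto
next
  case (insert x b)
  then obtain F where F: "finite F" "orthonormal H F" "S \<subseteq> F" "vs.span F = vs.span (S \<union> b)"
    by blast
  define z where "z = x - fproj F x"
  have eq: "vs.span (insert x F) = vs.span (S \<union> insert x b)"
    using F(4) by (simp add: vs.span_insert)
  show ?case
  proof (cases "z = 0")
    case True
    then have "x \<in> vs.span F" using fproj_in_span[of F x] by (simp add: z_def)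
    then show ?thesis using F eq by (auto simp: vs.span_redundant)
  next
    case False
    define u where "u = smult H (of_real (1 / norm z)) z"
    have "u \<in> orth H F"
      unfolding u_def using diff_fproj_orth[OF F(1,2)] subspace_orth
      by (simp add: z_def vs.subspace_scale)
    then have "orthonormal H (insert u F)"
      using F(2) normalize_unit[OF False] by (simp add: orthonormal_insert u_def)
    moreover have "vs.span (insert u F) = vs.span (insert x F)"
    proof (rule antisym)
      have "u \<in> vs.span (insert x F)"
        unfolding u_def z_def
        by (intro vs.span_scale vs.span_diff)
          (auto intro: vs.span_base subsetD[OF vs.span_mono fproj_in_span])
      then show "vs.span (insert u F) \<subseteq> vs.span (insert x F)"
        by (intro vs.span_minimal) (auto intro: vs.span_base)
      have "x = smult H (of_real (norm z)) u + fproj F x"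
        using False unfolding u_def by (simp add: z_def flip: of_real_mult)
      also have "\<dots> \<in> vs.span (insert u F)"
        by (intro vs.span_add vs.span_scale)
          (auto intro: vs.span_base subsetD[OF vs.span_mono fproj_in_span])
      finally show "vs.span (insert x F) \<subseteq> vs.span (insert u F)"
        by (intro vs.span_minimal) (auto intro: vs.span_base)
    qed
    ultimately show ?thesis using F eq by (intro exI[of _ "insert u F"]) auto
  qed
qed

lemma ex_orthonormal_basis:
  assumes "vs.subspace R" "R \<subseteq> vs.span b" "finite b"
  obtains F where "finite F" "orthonormal H F" "vs.span F = R" "card F = vs.dim R"
proof -
  obtain B where B: "B \<subseteq> R" "vs.independent B" "R \<subseteq> vs.span B"
    using vs.basis_exists[of R] by metis
  have "finite B" using vs.independent_span_bound[OF assms(3) B(2)] B(1) assms(2) by blast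
  from gram_schmidt[OF this, of "{}"] obtain F
    where F: "finite F" "orthonormal H F" "vs.span F = vs.span B" by auto
  then have "vs.span F = R"
    using vs.span_minimal[OF B(1) assms(1)] B(3) by auto
  then show ?thesis using that F dim_span_orthonormal[OF F(1,2)] by metis
qed

subsection \<open>Orthonormal bases\<close>

text \<open>Zorn's lemma gives a maximal orthonormal set; a vector outside its closed span would
  leave a nonzero remainder that could be normalized and added. Hence the choice in
  \<open>some_onb\<close> is a genuine basis.\<close>

lemma ex_onb: "\<exists>E. is_onb H E"
proof -
  define A where "A = {E. orthonormal H E}"
  have "\<exists>M\<in>A. \<forall>X\<in>A. M \<subseteq> X \<longrightarrow> X = M"
  proof (rule subset_Zorn_nonempty)
    show "A \<noteq> {}" using orthonormal_empty unfolding A_def by blast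
    fix \<C> assume C: "\<C> \<noteq> {}" "subset.chain A \<C>"
    show "\<Union> \<C> \<in> A"
      unfolding A_def mem_Collect_eq orthonormal_def
    proof (intro ballI)
      fix x y assume "x \<in> \<Union> \<C>" "y \<in> \<Union> \<C>"
      then obtain X Y where XY: "X \<in> \<C>" "Y \<in> \<C>" "x \<in> X" "y \<in> Y" by blast
      then have "X \<subseteq> Y \<or> Y \<subseteq> X" using C(2) by (auto simp: subset.chain_def)
      then obtain W where "W \<in> \<C>" "x \<in> W" "y \<in> W" using XY by blast
      then show "ip H x y = (if x = y then 1 else 0)"
        using C(2) by (auto simp: subset.chain_def A_def orthonormal_def)
    qed
  qed
  then obtain E where E: "orthonormal H E" "\<And>X. orthonormal H X \<Longrightarrow> E \<subseteq> X \<Longrightarrow> X = E"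
    by (auto simp: A_def)
  have "closure (vs.span E) = UNIV"
  proof (rule ccontr)
    assume "closure (vs.span E) \<noteq> UNIV"
    then obtain x where x: "x \<notin> closure (vs.span E)" by blast
    have V: "vs.subspace (closure (vs.span E))" by (intro subspace_closure vs.subspace_span)
    obtain p where p: "p \<in> closure (vs.span E)" "x - p \<in> orth H (closure (vs.span E))"
      using ex_projection[OF V closed_closure] by blast
    then have z: "x - p \<noteq> 0" "x - p \<in> orth H E"
      using x by (auto simp: orth_closure orth_span)
    define u where "u = smult H (of_real (1 / norm (x - p))) (x - p)"
    have "norm u = 1" "u \<in> orth H E"
      unfolding u_def using z normalize_unit vs.subspace_scale[OF subspace_orth] by auto
    then have "insert u E = E" using E orthonormal_insert by blast
    then have "u \<in> E" by blast
    with \<open>u \<in> orth H E\<close> have "u = 0" using in_orth_self by blast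
    then show False using \<open>norm u = 1\<close> by simp
  qed
  then show ?thesis using E by (auto simp: is_onb_def)
qed

lemma is_onb_some_onb: "is_onb H (some_onb H)"
  unfolding some_onb_def using ex_onb by (rule someI_ex)

lemma orthonormal_some_onb: "orthonormal H (some_onb H)"
  using is_onb_some_onb by (simp add: is_onb_def)

lemma parseval:
  assumes "is_onb H E"
  shows "((\<lambda>e. (norm (ip H x e))\<^sup>2) has_sum (norm x)\<^sup>2) E"
  unfolding has_sum_def tendsto_iff eventually_finite_subsets_at_top
proof (intro allI impI)
  fix \<epsilon> :: real assume "\<epsilon> > 0"
  have "x \<in> closure (vs.span E)" using assms by (simp add: is_onb_def)
  \<comment> \<open>The error of the sum is a squared distance, hence the root. Any finite
    \<open>Y\<close> containing the support of \<open>y\<close> approximates at least as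
    well.\<close>
  then obtain y where y: "y \<in> vs.span E" "dist y x < sqrt \<epsilon>"
    using \<open>\<epsilon> > 0\<close> unfolding closure_approachable by (meson real_sqrt_gt_zero)
  from y(1) obtain F g where F: "finite F" "F \<subseteq> E" "y = (\<Sum>a\<in>F. smult H (g a) a)"
    unfolding vs.span_explicit by blast
  show "\<exists>X. finite X \<and> X \<subseteq> E \<and>
      (\<forall>Y. finite Y \<and> X \<subseteq> Y \<and> Y \<subseteq> E \<longrightarrow> dist (\<Sum>e\<in>Y. (norm (ip H x e))\<^sup>2) ((norm x)\<^sup>2) < \<epsilon>)"
  proof (intro exI[of _ F] conjI allI impI F(1,2))
    fix Y assume Y: "finite Y \<and> F \<subseteq> Y \<and> Y \<subseteq> E"
    then have on: "orthonormal H Y"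
      using assms orthonormal_mono by (auto simp: is_onb_def)
    have "y \<in> vs.span Y"
      unfolding F(3) using Y by (intro vs.span_sum vs.span_scale vs.span_base) auto
    then have "(norm (x - fproj Y x))\<^sup>2 \<le> (norm (x - y))\<^sup>2"
      using norm_diff_span[of Y y x] Y on by simp
    also have "\<dots> < (sqrt \<epsilon>)\<^sup>2"
      using y(2) by (intro power_strict_mono) (auto simp: dist_norm norm_minus_commute)
    finally have "(norm (x - fproj Y x))\<^sup>2 < \<epsilon>" using \<open>\<epsilon> > 0\<close> by simp
    then show "dist (\<Sum>e\<in>Y. (norm (ip H x e))\<^sup>2) ((norm x)\<^sup>2) < \<epsilon>"
      using norm_fproj_decomp[of Y x] Y on by (simp add: dist_real_def)
  qed
qed

end

section \<open>Bounded operators\<close>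

locale bounded_operator = dom: hilbert_space H + cod: hilbert_space K
  for H :: "('k::rc_scalar, 'a::banach) hilbert" and K :: "('k, 'b::banach) hilbert" +
  fixes T :: "'a \<Rightarrow> 'b"
  assumes bounded_ops: "T \<in> bounded_ops H K"

lemma bounded_opsI:
  assumes "hilbert_space H" "hilbert_space K"
    and "\<And>x y. T (x + y) = T x + T y" "\<And>c x. T (smult H c x) = smult K c (T x)"
    and "\<And>x. norm (T x) \<le> c * norm x"
  shows "T \<in> bounded_ops H K"
  using assms by (auto simp: bounded_ops_def Vector_Spaces.linear_iff hilbert_space.vector_space_smult)

context bounded_operator
begin

lemma add: "T (x + y) = T x + T y"
  and smult: "T (smult H c x) = smult K c (T x)"
  and bounded: "\<exists>c. \<forall>x. norm (T x) \<le> c * norm x"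
  using bounded_ops by (auto simp: bounded_ops_def Vector_Spaces.linear_iff)

lemma ex_bound: "\<exists>c\<ge>0. \<forall>x. norm (T x) \<le> c * norm x"
proof -
  obtain c where c: "\<And>x. norm (T x) \<le> c * norm x" using bounded by blast
  have "norm (T x) \<le> max c 0 * norm x" for x
    using c[of x] by (meson max.cobounded1 mult_right_mono norm_ge_zero order_trans)
  then show ?thesis by (intro exI[of _ "max c 0"]) auto
qed

lemma zero: "T 0 = 0"
  using smult[of 0 0] by simp

lemma minus: "T (- x) = - T x"
  using add[of x "- x"] by (simp add: zero eq_neg_iff_add_eq_0 add.commute)

lemma diff: "T (x - y) = T x - T y"
  using add[of x "- y"] by (simp add: minus)

lemma sum: "T (sum f A) = (\<Sum>a\<in>A. T (f a))"
  by (induction A rule: infinite_finite_induct) (simp_all add: add zero)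

lemma bounded_linear: "bounded_linear T"
proof -
  obtain c where "\<And>x. norm (T x) \<le> c * norm x" using bounded by blast
  then show ?thesis
    by (intro bounded_linear_intro[where K = c])
      (auto simp: add smult mult.commute simp flip: dom.smult_of_real cod.smult_of_real)
qed

lemma continuous: "continuous_on S T"
  using bounded_linear by (rule linear_continuous_on)

lemma subspace_ker: "dom.vs.subspace (ker_op T)"
  by (auto simp: dom.vs.subspace_def ker_op_def zero add smult)

lemma closed_ker: "closed (ker_op T)"
  unfolding ker_op_def by (intro closed_Collect_eq continuous) auto

lemma subspace_image:
  assumes "dom.vs.subspace S"
  shows "cod.vs.subspace (T ` S)"
  unfolding cod.vs.subspace_def
proof (intro conjI ballI allI)
  show "0 \<in> T ` S" using dom.vs.subspace_0[OF assms] zero by force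
  fix x y assume "x \<in> T ` S" "y \<in> T ` S"
  then show "x + y \<in> T ` S" using dom.vs.subspace_add[OF assms] by (force simp flip: add)
next
  fix c x assume "x \<in> T ` S"
  then show "smult K c x \<in> T ` S" using dom.vs.subspace_scale[OF assms] by (force simp flip: smult)
qed

lemma subspace_range: "cod.vs.subspace (range T)"
  by (intro subspace_image dom.vs.subspace_UNIV)

lemma span_image: "T ` dom.vs.span b = cod.vs.span (T ` b)"
proof
  show "T ` dom.vs.span b \<subseteq> cod.vs.span (T ` b)"
  proof (rule image_subsetI)
    fix x assume "x \<in> dom.vs.span b"
    then show "T x \<in> cod.vs.span (T ` b)"
      by (induction rule: dom.vs.span_induct_alt)
        (auto simp: zero add smult intro!: cod.vs.span_zero cod.vs.span_add cod.vs.span_scale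
          intro: cod.vs.span_base)
  qed
  show "cod.vs.span (T ` b) \<subseteq> T ` dom.vs.span b"
    by (intro cod.vs.span_minimal subspace_image dom.vs.subspace_span image_mono) (auto intro: dom.vs.span_base)
qed

text \<open>If \<open>\<phi> \<noteq> 0\<close>, then \<open>w\<close> is a multiple of the component of \<open>T h\<^sub>0\<close> orthogonal to \<open>T (ker \<phi>)\<close>, where
  \<open>\<phi> h\<^sub>0 = 1\<close>; the bound ensures that this component does not vanish.\<close>

lemma functional_factors:
  assumes add': "\<And>x y. \<phi> (x + y) = \<phi> x + (\<phi> y :: 'k)"
    and smult': "\<And>a x. \<phi> (smult H a x) = a * \<phi> x"
    and bound: "\<And>x. norm (\<phi> x) \<le> c * norm (T x)"
  shows "\<exists>w. \<forall>x. \<phi> x = ip K (T x) w"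
proof (cases "\<forall>x. \<phi> x = 0")
  case True
  then show ?thesis by (intro exI[of _ 0]) simp
next
  case False
  then obtain h1 where h1: "\<phi> h1 \<noteq> 0" by blast
  define h0 where "h0 = smult H (1 / \<phi> h1) h1"
  have h0: "\<phi> h0 = 1" using h1 by (simp add: h0_def smult')
  have phi0: "\<phi> 0 = 0" using smult'[of 0 0] by simp
  have diff': "\<phi> (x - y) = \<phi> x - \<phi> y" for x y
    using add'[of "x - y" y] by simp
  define N where "N = {x. \<phi> x = 0}"
  have N: "dom.vs.subspace N"
    by (auto simp: dom.vs.subspace_def N_def phi0 add' smult')
  define V where "V = closure (T ` N)"
  have V: "cod.vs.subspace V" "closed V"
    unfolding V_def by (intro cod.subspace_closure subspace_image N, rule closed_closure)
  obtain p where p: "p \<in> V" "T h0 - p \<in> orth K V"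
    using cod.ex_projection[OF V] by blast
  define m where "m = T h0 - p"
  \<comment> \<open>Otherwise \<open>T h0\<close> is a limit of \<open>T (x n)\<close> with
    \<open>\<phi> (x n) = 0\<close>, and the bound gives
    \<open>1 \<le> c * norm (T h0 - T (x n))\<close>, whose right side tends to 0.\<close>
  have "m \<noteq> 0"
  proof
    assume "m = 0"
    then have "T h0 \<in> closure (T ` N)" using p(1) by (simp add: m_def V_def)
    then obtain f where f: "\<And>n. f n \<in> T ` N" "f \<longlonglongrightarrow> T h0"
      unfolding closure_sequential by blast
    then have "\<forall>n. \<exists>x. x \<in> N \<and> f n = T x" by blast
    then obtain x where x: "\<And>n. x n \<in> N" "\<And>n. f n = T (x n)" by metis
    have "1 \<le> c * norm (T h0 - f n)" for n
      using bound[of "h0 - x n"] x(1)[of n] by (simp add: N_def h0 diff' diff x(2))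
    moreover have "(\<lambda>n. c * norm (T h0 - f n)) \<longlonglongrightarrow> c * norm (T h0 - T h0)"
      by (intro tendsto_intros f)
    ultimately have "1 \<le> c * norm (T h0 - T h0)"
      by (intro LIMSEQ_le_const) auto
    then show False by simp
  qed
  have mm: "ip K (T h0) m = ip K m m"
    using cod.orthD'[OF p(2) p(1)] by (simp add: m_def cod.ip_diff_left)
  have "\<phi> x * ip K m m = ip K (T x) m" for x
  proof -
    have "x - smult H (\<phi> x) h0 \<in> N" by (simp add: N_def diff' smult' h0)
    then have "T (x - smult H (\<phi> x) h0) \<in> V" using closure_subset[of "T ` N"] by (auto simp: V_def)
    then have "ip K (T (x - smult H (\<phi> x) h0)) m = 0"
      using cod.orthD'[OF p(2)] by (simp add: m_def)
    then show ?thesis by (simp add: diff smult cod.ip_diff_left cod.ip_smult_left mm)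
  qed
  then have "\<phi> x = ip K (T x) (smult K (scnj (1 / ip K m m)) m)" for x
    using \<open>m \<noteq> 0\<close> by (metis cod.ip_self_eq_0 cod.ip_smult_right nonzero_mult_div_cancel_right
        scnj_scnj times_divide_eq_left mult_1)
  then show ?thesis by blast
qed

end

lemma (in hilbert_space) bounded_ops_ident: "(\<lambda>x. x) \<in> bounded_ops H H"
  by (rule bounded_opsI[where c = 1]) (auto intro: hilbert_space_axioms)

lemma (in hilbert_space) bounded_ops_proj:
  assumes "vs.subspace V" "closed V"
  shows "proj H V \<in> bounded_ops H H"
  by (rule bounded_opsI[where c = 1])
    (auto intro: hilbert_space_axioms simp: proj_add proj_smult norm_proj_le assms)

lemma bounded_ops_comp:
  assumes "bounded_operator H K T" "bounded_operator K L S"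
  shows "S \<circ> T \<in> bounded_ops H L"
proof -
  interpret T: bounded_operator H K T by fact
  interpret S: bounded_operator K L S by fact
  obtain c where c: "\<And>x. norm (T x) \<le> c * norm x" using T.ex_bound by blast
  obtain d where d: "d \<ge> 0" "\<And>x. norm (S x) \<le> d * norm x" using S.ex_bound by blast
  show ?thesis
  proof (rule bounded_opsI[where c = "d * c"])
    show "norm ((S \<circ> T) x) \<le> d * c * norm x" for x
      using d(2)[of "T x"] mult_left_mono[OF c[of x] d(1)] by simp
  qed (auto simp: T.add T.smult S.add S.smult intro: T.dom.hilbert_space_axioms S.cod.hilbert_space_axioms)
qed

lemma (in hilbert_space) riesz:
  assumes "\<And>x y. \<phi> (x + y) = \<phi> x + (\<phi> y :: 'k)" "\<And>a x. \<phi> (smult H a x) = a * \<phi> x"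
    and "\<And>x. norm (\<phi> x) \<le> c * norm x"
  shows "\<exists>w. \<forall>x. \<phi> x = ip H x w"
proof -
  interpret bounded_operator H H "\<lambda>x. x"
    by unfold_locales (rule bounded_ops_ident)
  show ?thesis using functional_factors[of \<phi> c] assms by simp
qed

context bounded_operator
begin

subsection \<open>Adjoints\<close>

lemma ip_adj: "ip K (T x) y = ip H x (adj H K T y)"
proof -
  obtain c where c: "c \<ge> 0" "\<And>x. norm (T x) \<le> c * norm x" using ex_bound by blast
  have "\<exists>w. \<forall>x. ip K (T x) y = ip H x w" for y
  proof (rule dom.riesz)
    show "norm (ip K (T x) y) \<le> (c * norm y) * norm x" for x
      using cod.cauchy_schwarz[of "T x" y] mult_right_mono[OF c(2)[of x], of "norm y"]
      by (simp add: mult_ac)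
  qed (simp_all add: add smult cod.ip_simps)
  then obtain S where S: "\<forall>x y. ip K (T x) y = ip H x (S y)" by metis
  have "S' = S" if "\<forall>x y. ip K (T x) y = ip H x (S' y)" for S'
  proof (intro ext dom.eqI_ip)
    fix y z
    show "ip H (S' y) z = ip H (S y) z"
      using S that unfolding dom.ip_scnj[of _ z] by simp
  qed
  with S have "\<forall>x y. ip K (T x) y = ip H x (adj H K T y)"
    unfolding adj_def by (rule theI)
  then show ?thesis by blast
qed

lemma ip_adj': "ip H (adj H K T y) x = ip K y (T x)"
  by (metis ip_adj cod.ip_scnj dom.ip_scnj)

lemma adj_eqI:
  assumes "\<And>x y. ip K (T x) y = ip H x (S y)"
  shows "adj H K T = S"
proof (intro ext dom.eqI_ip)
  fix y z
  have "ip H z (adj H K T y) = ip H z (S y)" by (simp add: assms flip: ip_adj)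
  then show "ip H (adj H K T y) z = ip H (S y) z"
    unfolding dom.ip_scnj[of _ z] by simp
qed

lemma adj_bounded_ops: "adj H K T \<in> bounded_ops K H"
proof -
  obtain c where c: "c \<ge> 0" "\<And>x. norm (T x) \<le> c * norm x" using ex_bound by blast
  show ?thesis
  proof (rule bounded_opsI[where c = c])
    show "norm (adj H K T y) \<le> c * norm y" for y
    proof (cases "adj H K T y = 0")
      case False
      let ?z = "adj H K T y"
      have "(norm ?z)\<^sup>2 = norm (ip K (T ?z) y)"
        by (simp add: ip_adj dom.ip_self norm_power)
      also have "\<dots> \<le> norm (T ?z) * norm y" by (rule cod.cauchy_schwarz)
      also have "\<dots> \<le> c * norm ?z * norm y" by (intro mult_right_mono c) simp
      finally show ?thesis using False by (simp add: power2_eq_square)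
    qed (use c in simp)
  qed (auto intro!: dom.eqI_ip cod.hilbert_space_axioms dom.hilbert_space_axioms
      simp: dom.ip_simps cod.ip_simps ip_adj')
qed

end

text \<open>The rewrite collapses the double adjoint, so every fact has a usable dual:
  \<open>adj.orth_ker\<close> identifies the orthogonal complement of the kernel of the adjoint with
  the closure of \<open>range T\<close>.\<close>

sublocale bounded_operator \<subseteq> adj: bounded_operator K H "adj H K T"
  rewrites "adj K H (adj H K T) = T"
proof -
  show adj: "bounded_operator K H (adj H K T)"
    by unfold_locales (rule adj_bounded_ops)
  show "adj K H (adj H K T) = T"
    by (rule bounded_operator.adj_eqI[OF adj]) (rule ip_adj')
qed

context bounded_operator
begin

lemma orth_range_adj: "orth H (range (adj H K T)) = ker_op T"
proof -
  have "T x = 0 \<longleftrightarrow> (\<forall>y. ip K (T x) y = 0)" for x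
    by (metis cod.ip_self_eq_0 cod.ip_zero_left)
  then show ?thesis by (auto simp: orth_def ker_op_def ip_adj)
qed

lemma orth_ker: "orth H (ker_op T) = closure (range (adj H K T))"
  unfolding orth_range_adj[symmetric] by (rule dom.orth_orth) (rule adj.subspace_range)

subsection \<open>The Moore--Penrose inverse\<close>

lemma ker_decomp:
  obtains h h' where "x = h + h'" "h \<in> orth H (ker_op T)" "h' \<in> ker_op T" "T x = T h"
proof -
  obtain p where p: "p \<in> ker_op T" "x - p \<in> orth H (ker_op T)"
    using dom.ex_projection[OF subspace_ker closed_ker] by blast
  then show ?thesis by (intro that[of "x - p" p]) (auto simp: diff ker_op_def)
qed

lemma inj_on_orth_ker: "inj_on T (orth H (ker_op T))"
proof (rule inj_onI)
  fix x y assume xy: "x \<in> orth H (ker_op T)" "y \<in> orth H (ker_op T)" "T x = T y"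
  then have "x - y \<in> orth H (ker_op T)" "x - y \<in> ker_op T"
    using dom.vs.subspace_diff[OF dom.subspace_orth] by (auto simp: ker_op_def diff)
  then show "x = y" using dom.in_orth_self by force
qed

lemma mp_inv_eq:
  assumes "h \<in> orth H (ker_op T)" "k \<in> orth K (range T)"
  shows "mp_inv H K T (T h + k) = h"
proof -
  have "(THE y. y \<in> range T \<and> (T h + k) - y \<in> orth K (range T)) = T h"
  proof (rule the_equality)
    show "y = T h" if "y \<in> range T \<and> T h + k - y \<in> orth K (range T)" for y
      using cod.projection_unique[OF subspace_range, of y "T h + k" "T h"] that assms(2) by simp
  qed (use assms(2) in simp)
  then show ?thesis
    using the_inv_into_f_f[OF inj_on_orth_ker assms(1)] by (simp add: mp_inv_def)
qed

lemma mp_dom_cases: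
  assumes "y \<in> mp_dom K T"
  obtains h k where "y = T h + k" "h \<in> orth H (ker_op T)" "k \<in> orth K (range T)"
proof -
  from assms obtain x k where "y = T x + k" "k \<in> orth K (range T)" by (auto simp: mp_dom_def)
  with ker_decomp[of x] show ?thesis using that by metis
qed

lemma mp_domI: "k \<in> orth K (range T) \<Longrightarrow> T h + k \<in> mp_dom K T"
  by (auto simp: mp_dom_def)

lemma range_subset_mp_dom: "range T \<subseteq> mp_dom K T"
  using mp_domI[of 0] cod.vs.subspace_0[OF cod.subspace_orth] by auto

lemma subspace_mp_dom: "cod.vs.subspace (mp_dom K T)"
  unfolding mp_dom_def
  using cod.vs.subspace_sums[OF subspace_range cod.subspace_orth[of "range T"]] .

lemma mp_inv_add:
  assumes "y \<in> mp_dom K T" "z \<in> mp_dom K T"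
  shows "mp_inv H K T (y + z) = mp_inv H K T y + mp_inv H K T z"
proof -
  from assms obtain h k h' k' where
    y: "y = T h + k" "h \<in> orth H (ker_op T)" "k \<in> orth K (range T)" and
    z: "z = T h' + k'" "h' \<in> orth H (ker_op T)" "k' \<in> orth K (range T)"
    by (metis mp_dom_cases)
  have eq: "y + z = T (h + h') + (k + k')" by (simp add: y z add)
  show ?thesis
    unfolding eq using y z by (simp add: mp_inv_eq dom.vs.subspace_add[OF dom.subspace_orth]
        cod.vs.subspace_add[OF cod.subspace_orth])
qed

lemma mp_inv_smult:
  assumes "y \<in> mp_dom K T"
  shows "mp_inv H K T (smult K c y) = smult H c (mp_inv H K T y)"
proof -
  from assms obtain h k where
    y: "y = T h + k" "h \<in> orth H (ker_op T)" "k \<in> orth K (range T)"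
    by (metis mp_dom_cases)
  have eq: "smult K c y = T (smult H c h) + smult K c k"
    by (simp add: y smult cod.vs.scale_right_distrib)
  show ?thesis
    unfolding eq using y by (simp add: mp_inv_eq dom.vs.subspace_scale[OF dom.subspace_orth]
        cod.vs.subspace_scale[OF cod.subspace_orth])
qed

text \<open>The part of \<open>y\<close> orthogonal to the range also lies in the closure of the
  range and so vanishes. This turns domain conditions into solvability of \<open>T x = y\<close>,
  both for \<open>B\<close> and for the adjoint of \<open>C\<close>.\<close>

lemma mp_dom_closure_range:
  assumes "y \<in> mp_dom K T" "y \<in> closure (range T)"
  shows "y \<in> range T" "T (mp_inv H K T y) = y"
proof -
  obtain h k where y: "y = T h + k" "h \<in> orth H (ker_op T)" "k \<in> orth K (range T)"
    using assms(1) by (metis mp_dom_cases)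
  have "T h \<in> closure (range T)" using closure_subset[of "range T"] by (rule subsetD) simp
  then have "y - T h \<in> closure (range T)"
    using cod.vs.subspace_diff[OF cod.subspace_closure[OF subspace_range] assms(2)] by blast
  moreover have "k \<in> orth K (closure (range T))" using y(3) by (simp add: cod.orth_closure)
  ultimately have "k = 0" using cod.in_orth_self y(1) by force
  then show "y \<in> range T" "T (mp_inv H K T y) = y"
    using mp_inv_eq[OF y(2,3)] y(1) by auto
qed

end

section \<open>Singular value decompositions\<close>

text \<open>A basis-free variant of \<^const>\<open>hs_ops\<close>.\<close>

definition hilbert_schmidt ::
  "('k::rc_scalar, 'a::banach) hilbert \<Rightarrow> ('k, 'b::banach) hilbert \<Rightarrow> ('a \<Rightarrow> 'b) \<Rightarrow> bool"
  where "hilbert_schmidt H K T \<longleftrightarrow>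
    (\<exists>c. \<forall>F. finite F \<longrightarrow> orthonormal H F \<longrightarrow> (\<Sum>f\<in>F. (norm (T f))\<^sup>2) \<le> c)"

lemma hilbert_schmidt_diff:
  assumes "hilbert_schmidt H K S" "hilbert_schmidt H K T"
  shows "hilbert_schmidt H K (\<lambda>x. S x - T x)"
proof -
  obtain c where c: "\<And>F. finite F \<Longrightarrow> orthonormal H F \<Longrightarrow> (\<Sum>f\<in>F. (norm (S f))\<^sup>2) \<le> c"
    using assms(1) unfolding hilbert_schmidt_def by blast
  obtain d where d: "\<And>F. finite F \<Longrightarrow> orthonormal H F \<Longrightarrow> (\<Sum>f\<in>F. (norm (T f))\<^sup>2) \<le> d"
    using assms(2) unfolding hilbert_schmidt_def by blast
  have pt: "(norm (S f - T f))\<^sup>2 \<le> 2 * (norm (S f))\<^sup>2 + 2 * (norm (T f))\<^sup>2" for f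
  proof -
    have "(norm (S f - T f))\<^sup>2 \<le> (norm (S f) + norm (T f))\<^sup>2"
      by (intro power_mono norm_triangle_ineq4) simp
    also have "\<dots> \<le> 2 * (norm (S f))\<^sup>2 + 2 * (norm (T f))\<^sup>2"
      using zero_le_power2[of "norm (S f) - norm (T f)"]
      by (simp add: power2_eq_square algebra_simps)
    finally show ?thesis .
  qed
  have "(\<Sum>f\<in>F. (norm (S f - T f))\<^sup>2) \<le> 2 * c + 2 * d" if "finite F" "orthonormal H F" for F
  proof -
    have "(\<Sum>f\<in>F. (norm (S f - T f))\<^sup>2) \<le> (\<Sum>f\<in>F. 2 * (norm (S f))\<^sup>2 + 2 * (norm (T f))\<^sup>2)"
      by (intro sum_mono pt)
    then show ?thesis using c[OF that] d[OF that] by (simp add: sum.distrib sum_distrib_left[symmetric])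
  qed
  then show ?thesis by (auto simp: hilbert_schmidt_def)
qed

section \<open>Rank-one corrections of Hilbert-Schmidt operators\<close>

context bounded_operator
begin

lemma bounded_ops_rank_one: "(\<lambda>x. smult K (ip H x u) w) \<in> bounded_ops H K"
proof (rule bounded_opsI[where c = "norm u * norm w"])
  show "norm (smult K (ip H x u) w) \<le> norm u * norm w * norm x" for x
    using mult_right_mono[OF dom.cauchy_schwarz[of x u], of "norm w"]
    by (simp add: cod.norm_smult mult_ac)
qed (auto simp: dom.ip_simps cod.vs.scale_left_distrib
    intro: dom.hilbert_space_axioms cod.hilbert_space_axioms)

lemma bounded_ops_diff:
  assumes "S \<in> bounded_ops H K"
  shows "(\<lambda>x. T x - S x) \<in> bounded_ops H K"
proof -
  interpret S: bounded_operator H K S by unfold_locales fact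
  obtain c where c: "\<And>x. norm (T x) \<le> c * norm x" using bounded by blast
  obtain d where d: "\<And>x. norm (S x) \<le> d * norm x" using S.bounded by blast
  show ?thesis
  proof (rule bounded_opsI[where c = "c + d"])
    show "norm (T x - S x) \<le> (c + d) * norm x" for x
      using c[of x] d[of x] norm_triangle_ineq4[of "T x" "S x"] by (simp add: distrib_right)
  qed (auto simp: add smult S.add S.smult cod.vs.scale_right_diff_distrib
      intro: dom.hilbert_space_axioms cod.hilbert_space_axioms)
qed

lemma hilbert_schmidt_rank_one: "hilbert_schmidt H K (\<lambda>x. smult K (ip H x u) w)"
proof -
  have "(\<Sum>f\<in>F. (norm (smult K (ip H f u) w))\<^sup>2) \<le> (norm u)\<^sup>2 * (norm w)\<^sup>2"
    if "finite F" "orthonormal H F" for F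
    using mult_right_mono[OF dom.bessel[OF that, of u], of "(norm w)\<^sup>2"]
    by (simp add: cod.norm_smult power_mult_distrib sum_distrib_right dom.norm_ip_commute[of u])
  then show ?thesis unfolding hilbert_schmidt_def by blast
qed

end

text \<open>Each further vector adds a factor \<open>cball 0 1\<close> of scalars to the parameter
  space, compact by \<open>compact_cball_scalar\<close>.\<close>

lemma (in hilbert_space) compact_combinations:
  assumes "finite F"
  shows "compact {\<Sum>f\<in>F. smult H (c f) (v f) |c. \<forall>f\<in>F. norm (c f) \<le> 1}"
  using assms
proof (induction F rule: finite_induct)
  case empty
  then show ?case by simp
next
  case (insert x F)
  let ?S = "\<lambda>F. {\<Sum>f\<in>F. smult H (c f) (v f) |c. \<forall>f\<in>F. norm (c f) \<le> 1}"
  have "?S (insert x F) = (\<lambda>p. smult H (fst p) (v x) + snd p) ` (cball 0 1 \<times> ?S F)"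
  proof (intro equalityI subsetI)
    fix y assume "y \<in> ?S (insert x F)"
    then obtain c where "\<forall>f\<in>insert x F. norm (c f) \<le> 1"
      "y = (\<Sum>f\<in>insert x F. smult H (c f) (v f))" by blast
    then show "y \<in> (\<lambda>p. smult H (fst p) (v x) + snd p) ` (cball 0 1 \<times> ?S F)"
      using insert(1,2) by (intro image_eqI[of _ _ "(c x, \<Sum>f\<in>F. smult H (c f) (v f))"]) auto
  next
    fix y assume "y \<in> (\<lambda>p. smult H (fst p) (v x) + snd p) ` (cball 0 1 \<times> ?S F)"
    then obtain a c where ac: "norm a \<le> 1" "\<forall>f\<in>F. norm (c f) \<le> 1"
      "y = smult H a (v x) + (\<Sum>f\<in>F. smult H (c f) (v f))" by auto
    have "(\<Sum>f\<in>F. smult H ((c(x := a)) f) (v f)) = (\<Sum>f\<in>F. smult H (c f) (v f))"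
      using insert(2) by (intro sum.cong) auto
    then show "y \<in> ?S (insert x F)"
      using ac insert(1,2) by (auto intro!: exI[of _ "c(x := a)"])
  qed
  moreover have "compact ((\<lambda>p. smult H (fst p) (v x) + snd p) ` (cball 0 1 \<times> ?S F))"
    by (intro compact_continuous_image compact_Times compact_cball_scalar insert.IH continuous_on_add
        linear_continuous_on bounded_linear_compose[OF bounded_linear_smult_left]
        bounded_linear_fst bounded_linear_snd)
  ultimately show ?case by simp
qed

text \<open>A nonzero inner product would make the norm grow to first order along a suitable
  direction, against a bound of second order in \<open>t\<close>.\<close>

lemma (in hilbert_space) ip_eq_0_if_maximal:
  assumes "\<And>t. (norm (z + smult H t y))\<^sup>2 \<le> (norm z)\<^sup>2 + c * (norm t)\<^sup>2"
  shows "ip H z y = 0"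
proof (rule ccontr)
  assume ne: "ip H z y \<noteq> 0"
  define p where "p = (norm (ip H z y))\<^sup>2"
  have p: "p > 0" using ne by (simp add: p_def)
  \<comment> \<open>Chosen so that \<open>c * s < 1\<close>, while the assumption would force
    \<open>2 \<le> c * s\<close>.\<close>
  define s where "s = 1 / (1 + \<bar>c\<bar>)"
  have s: "s > 0" by (simp add: s_def add_pos_nonneg)
  have "(2 * s + s\<^sup>2 * (norm y)\<^sup>2) * p \<le> c * (s\<^sup>2 * p)"
    using assms[of "of_real s * ip H z y"] norm_add_smult_ip[of z s y]
    by (simp add: norm_mult power_mult_distrib p_def)
  then have "2 * s + s\<^sup>2 * (norm y)\<^sup>2 \<le> c * s\<^sup>2" using p by (simp flip: mult.assoc)
  then have "2 * s \<le> c * s\<^sup>2" using zero_le_power2[of "s * norm y"] unfolding power_mult_distrib by linarith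
  then have "2 \<le> c * s" using s by (simp add: power2_eq_square)
  also have "c * s \<le> \<bar>c\<bar> / (1 + \<bar>c\<bar>)" by (simp add: s_def divide_right_mono)
  also have "\<dots> < 1" by simp
  finally show False by simp
qed

section \<open>Compactness and attainment of the norm\<close>

locale hilbert_schmidt_operator = bounded_operator H K T
  for H :: "('k::rc_scalar, 'a::banach) hilbert" and K :: "('k, 'b::banach) hilbert" and T +
  assumes hilbert_schmidt: "hilbert_schmidt H K T"
begin

text \<open>Take \<open>F\<close> whose sum is within \<open>\<epsilon>\<^sup>2\<close> of the
  supremum: adjoining a unit vector orthogonal to \<open>F\<close> cannot raise the sum by
  more.\<close>

lemma small_on_orth:
  assumes "\<epsilon> > 0"
  obtains F where "finite F" "orthonormal H F" "\<And>x. x \<in> orth H F \<Longrightarrow> norm (T x) \<le> \<epsilon> * norm x"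
proof -
  define S where "S = {\<Sum>f\<in>F. (norm (T f))\<^sup>2 |F. finite F \<and> orthonormal H F}"
  have bdd: "bdd_above S"
    using hilbert_schmidt unfolding S_def hilbert_schmidt_def by (auto simp: bdd_above_def)
  have "0 \<in> S" unfolding S_def mem_Collect_eq by (rule exI[of _ "{}"]) simp
  then have ne: "S \<noteq> {}" by blast
  have "Sup S - \<epsilon>\<^sup>2 < Sup S" using assms by simp
  then obtain F where F: "finite F" "orthonormal H F" "Sup S - \<epsilon>\<^sup>2 < (\<Sum>f\<in>F. (norm (T f))\<^sup>2)"
    using less_cSup_iff[OF ne bdd, of "Sup S - \<epsilon>\<^sup>2"] unfolding S_def by blast
  show ?thesis
  proof (rule that[OF F(1,2)])
    fix x assume x: "x \<in> orth H F"
    show "norm (T x) \<le> \<epsilon> * norm x"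
    proof (cases "x = 0")
      case False
      define u where "u = smult H (of_real (1 / norm x)) x"
      have u: "norm u = 1" "u \<in> orth H F"
        unfolding u_def using dom.normalize_unit[OF False] dom.vs.subspace_scale[OF dom.subspace_orth x]
        by auto
      then have "u \<notin> F" using dom.in_orth_self[of u F] by auto
      have "(\<Sum>f\<in>insert u F. (norm (T f))\<^sup>2) \<in> S"
        unfolding S_def using F(1,2) dom.orthonormal_insert[OF F(2) u] by blast
      then have "(norm (T u))\<^sup>2 + (\<Sum>f\<in>F. (norm (T f))\<^sup>2) \<le> Sup S"
        using cSup_upper[OF _ bdd] F(1) \<open>u \<notin> F\<close> by simp
      then have "(norm (T u))\<^sup>2 \<le> \<epsilon>\<^sup>2" using F(3) by linarith
      then have "norm (T u) \<le> \<epsilon>" using assms power2_le_imp_le[of "norm (T u)" \<epsilon>] by simp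
      then show ?thesis using False
        by (simp add: u_def smult cod.norm_smult norm_divide divide_le_eq)
    qed (simp add: zero)
  qed
qed

lemma compact_closure_image: "compact (closure (T ` cball 0 1))"
  unfolding compact_eq_totally_bounded
proof (intro conjI allI impI)
  show "complete (closure (T ` cball 0 1))" by (simp add: complete_eq_closed)
  fix e :: real assume e: "e > 0"
  \<comment> \<open>One share for the finite net of \<open>Q\<close>, one for the part orthogonal to
    \<open>F\<close>. The third turns the closed balls, needed to pass to the closure, into open
    ones.\<close>
  define \<epsilon> where "\<epsilon> = e / 3"
  have eps: "\<epsilon> > 0" using e by (simp add: \<epsilon>_def)
  obtain F where F: "finite F" "orthonormal H F" "\<And>x. x \<in> orth H F \<Longrightarrow> norm (T x) \<le> \<epsilon> * norm x"
    using small_on_orth[OF eps] by blast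
  define Q where "Q = {\<Sum>f\<in>F. smult K (c f) (T f) |c. \<forall>f\<in>F. norm (c f) \<le> 1}"
  have "compact Q" unfolding Q_def by (rule cod.compact_combinations[OF F(1)])
  then obtain k where k: "finite k" "Q \<subseteq> (\<Union>y\<in>k. ball y \<epsilon>)"
    using eps unfolding compact_eq_totally_bounded by blast
  have "T ` cball 0 1 \<subseteq> (\<Union>y\<in>k. cball y (2 * \<epsilon>))"
  proof (rule image_subsetI)
    fix x :: 'a assume "x \<in> cball 0 1"
    then have x: "norm x \<le> 1" by simp
    have "norm (ip H x f) \<le> 1" if "f \<in> F" for f
      using dom.cauchy_schwarz[of x f] dom.orthonormal_norm[OF F(2) that] x by simp
    then have "T (dom.fproj F x) \<in> Q"
      unfolding Q_def dom.fproj_def sum smult by blast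
    then obtain y where y: "y \<in> k" "dist y (T (dom.fproj F x)) < \<epsilon>" using k(2) by auto
    have "(norm (x - dom.fproj F x))\<^sup>2 \<le> (norm x)\<^sup>2"
      using dom.norm_fproj_decomp[OF F(1,2), of x] by (simp add: sum_nonneg)
    then have "norm (x - dom.fproj F x) \<le> 1" using x by (meson norm_ge_zero order_trans power2_le_imp_le)
    then have "norm (T (x - dom.fproj F x)) \<le> \<epsilon> * 1"
      using F(3)[OF dom.diff_fproj_orth[OF F(1,2)], of x] eps
      by (meson less_imp_le mult_left_mono order_trans)
    then have "dist (T (dom.fproj F x)) (T x) \<le> \<epsilon>"
      by (simp add: diff dist_norm norm_minus_commute)
    then have "dist y (T x) \<le> 2 * \<epsilon>"
      using y(2) dist_triangle[of y "T x" "T (dom.fproj F x)"] by linarith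
    then show "T x \<in> (\<Union>y\<in>k. cball y (2 * \<epsilon>))" using y(1) by auto
  qed
  then have "closure (T ` cball 0 1) \<subseteq> (\<Union>y\<in>k. cball y (2 * \<epsilon>))"
    by (intro closure_minimal closed_UN k(1)) auto
  also have "\<dots> \<subseteq> (\<Union>y\<in>k. ball y e)"
    using eps by (intro UN_mono) (auto simp: \<epsilon>_def)
  finally show "\<exists>k. finite k \<and> closure (T ` cball 0 1) \<subseteq> (\<Union>x\<in>k. ball x e)"
    using k(1) by blast
qed

text \<open>By compactness the images of a maximizing sequence \<open>z\<close> converge along a subsequence.  The
  parallelogram law then makes the subsequence itself Cauchy: \<open>T (z m + z n)\<close> has norm close to
  \<open>2 \<parallel>T\<parallel>\<close>, so \<open>z m + z n\<close> has norm close to \<open>2\<close>.\<close>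

lemma ex_maximizer: "\<exists>e. (\<forall>x. norm (T x) \<le> norm (T e) * norm x) \<and> (T e \<noteq> 0 \<longrightarrow> norm e = 1)"
proof (cases "\<forall>x. T x = 0")
  \<comment> \<open>The space may be trivial and contain no unit vector; hence the normalization is
    claimed only for \<open>T e \<noteq> 0\<close>, and 0 serves as witness.\<close>
  case True
  then show ?thesis by (intro exI[of _ 0]) simp
next
  case False
  define \<sigma> where "\<sigma> = onorm T"
  have le: "norm (T x) \<le> \<sigma> * norm x" for x
    unfolding \<sigma>_def by (rule onorm[OF bounded_linear])
  have pos: "\<sigma> > 0"
    using False onorm_pos_lt[OF bounded_linear] by (auto simp: \<sigma>_def)
  have "\<exists>x. norm x = 1 \<and> \<sigma> * (1 - 1 / Suc (Suc n)) < norm (T x)" for n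
  proof (rule ccontr)
    assume H: "\<not> ?thesis"
    have "norm (T x) \<le> \<sigma> * (1 - 1 / Suc (Suc n)) * norm x" for x
    proof (cases "x = 0")
      case False
      have "norm (T (smult H (of_real (1 / norm x)) x)) \<le> \<sigma> * (1 - 1 / Suc (Suc n))"
        using H dom.normalize_unit[OF False] by (meson not_le)
      then show ?thesis using False
        by (simp add: smult cod.norm_smult norm_divide divide_le_eq)
    qed (simp add: zero)
    then have "\<sigma> \<le> \<sigma> * (1 - 1 / Suc (Suc n))"
      unfolding \<sigma>_def using pos by (intro onorm_bound) (auto simp: \<sigma>_def)
    then show False using pos by (simp add: field_simps)
  qed
  then obtain x where x: "\<And>n. norm (x n) = 1" "\<And>n. \<sigma> * (1 - 1 / Suc (Suc n)) < norm (T (x n))"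
    by metis
  have "\<forall>n. T (x n) \<in> closure (T ` cball 0 1)"
    using x(1) by (intro allI subsetD[OF closure_subset]) auto
  then obtain y r where r: "strict_mono r" "((\<lambda>n. T (x n)) \<circ> r) \<longlonglongrightarrow> y"
    using compact_closure_image unfolding compact_def by metis
  define z where "z n = x (r n)" for n
  have z1: "norm (z n) = 1" for n by (simp add: z_def x)
  have Tz: "(\<lambda>n. T (z n)) \<longlonglongrightarrow> y" using r(2) by (simp add: z_def o_def)
  have "(\<lambda>n. norm (T (x n))) \<longlonglongrightarrow> \<sigma>"
  proof (rule tendsto_sandwich)
    show "\<forall>\<^sub>F n in sequentially. \<sigma> * (1 - 1 / real (Suc (Suc n))) \<le> norm (T (x n))"
      using x(2) by (intro always_eventually allI less_imp_le)
    show "\<forall>\<^sub>F n in sequentially. norm (T (x n)) \<le> \<sigma>"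
      using le x(1) by (intro always_eventually allI) (metis mult.right_neutral)
    have "(\<lambda>n. \<sigma> * (1 - 1 / real (Suc (Suc n)))) \<longlonglongrightarrow> \<sigma> * (1 - 0)"
      by (intro tendsto_intros LIMSEQ_Suc lim_1_over_n)
    then show "(\<lambda>n. \<sigma> * (1 - 1 / real (Suc (Suc n)))) \<longlonglongrightarrow> \<sigma>" by simp
  qed simp
  then have "(\<lambda>n. norm (T (z n))) \<longlonglongrightarrow> \<sigma>"
    using LIMSEQ_subseq_LIMSEQ[OF _ r(1)] by (fastforce simp: z_def o_def)
  then have ny: "norm y = \<sigma>" using tendsto_norm[OF Tz] LIMSEQ_unique by blast
  have "Cauchy z"
  proof (rule metric_CauchyI)
    fix e :: real assume "e > 0"
    \<comment> \<open>The bound 1/2 keeps \<open>2 * (1 - \<delta>)\<close> nonnegative before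
      squaring; the final estimate \<open>8 * \<delta>\<close> must be strictly below
      \<open>e\<^sup>2\<close>.\<close>
    define \<delta> where "\<delta> = min (1/2) (e\<^sup>2 / 9)"
    have d: "\<delta> > 0" "\<delta> \<le> 1/2" "9 * \<delta> \<le> e\<^sup>2" using \<open>e > 0\<close> by (auto simp: \<delta>_def)
    have "\<delta> * \<sigma> > 0" using d pos by simp
    then obtain N where N: "\<And>n. n \<ge> N \<Longrightarrow> dist (T (z n)) y < \<delta> * \<sigma>"
      using Tz unfolding lim_sequentially by blast
    show "\<exists>M. \<forall>m\<ge>M. \<forall>n\<ge>M. dist (z m) (z n) < e"
    proof (intro exI[of _ N] allI impI)
      fix m n assume mn: "m \<ge> N" "n \<ge> N"
      have eq: "2 *\<^sub>R y = T (z m + z n) - ((T (z m) - y) + (T (z n) - y))"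
        by (simp add: add scaleR_2)
      have "norm (2 *\<^sub>R y) \<le> norm (T (z m + z n)) + (norm (T (z m) - y) + norm (T (z n) - y))"
        unfolding eq
        using norm_triangle_ineq4[of "T (z m + z n)" "(T (z m) - y) + (T (z n) - y)"]
          norm_triangle_ineq[of "T (z m) - y" "T (z n) - y"] by linarith
      also have "\<dots> \<le> \<sigma> * norm (z m + z n) + 2 * (\<delta> * \<sigma>)"
        using N[OF mn(1)] N[OF mn(2)] le[of "z m + z n"] unfolding dist_norm by linarith
      finally have "\<sigma> * (2 * (1 - \<delta>)) \<le> \<sigma> * norm (z m + z n)"
        using ny by (simp add: algebra_simps)
      then have "2 * (1 - \<delta>) \<le> norm (z m + z n)" using pos by simp
      then have "(2 * (1 - \<delta>))\<^sup>2 \<le> (norm (z m + z n))\<^sup>2" using d by (intro power_mono) auto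
      moreover have "(norm (z m + z n))\<^sup>2 + (norm (z m - z n))\<^sup>2 = 4"
        using dom.parallelogram[of "z m" "z n"] z1 by simp
      moreover have "(2 * (1 - \<delta>))\<^sup>2 = 4 - 8 * \<delta> + 4 * \<delta>\<^sup>2" by (simp add: power2_eq_square algebra_simps)
      ultimately have "(norm (z m - z n))\<^sup>2 \<le> 8 * \<delta>" using zero_le_power2[of \<delta>] by linarith
      also have "\<dots> < e\<^sup>2" using d by linarith
      finally show "dist (z m) (z n) < e"
        using \<open>e > 0\<close> by (simp add: dist_norm power_less_imp_less_base)
    qed
  qed
  then obtain e where e: "z \<longlonglongrightarrow> e" using Cauchy_convergent convergent_def by blast
  have "(\<lambda>n. T (z n)) \<longlonglongrightarrow> T e" by (rule bounded_linear.tendsto[OF bounded_linear e])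
  then have "norm (T e) = \<sigma>" using Tz LIMSEQ_unique ny by blast
  moreover have "norm e = 1"
    using tendsto_norm[OF e] z1 LIMSEQ_unique[OF _ tendsto_const] by simp
  ultimately show ?thesis using le by (intro exI[of _ e]) auto
qed

end

text \<open>Moving from \<open>e\<close> in an orthogonal direction changes the squared norm only to
  second order, so non-orthogonal images would beat the maximum to first order.\<close>

lemma (in bounded_operator) maximizer_image_orth:
  assumes "\<And>x. norm (T x) \<le> norm (T e) * norm x" "norm e = 1" "x \<in> orth H {e}"
  shows "ip K (T e) (T x) = 0"
proof (rule cod.ip_eq_0_if_maximal)
  fix t
  have "ip H e (smult H t x) = 0"
    using dom.orthD'[OF assms(3)] by (simp add: dom.ip_smult_right)
  then have nrm: "(norm (e + smult H t x))\<^sup>2 = 1 + (norm t * norm x)\<^sup>2"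
    using dom.pythagoras[of e "smult H t x"] assms(2) by (simp add: dom.norm_smult)
  have "(norm (T (e + smult H t x)))\<^sup>2 \<le> (norm (T e) * norm (e + smult H t x))\<^sup>2"
    by (intro power_mono assms(1)) simp
  then show "(norm (T e + smult K t (T x)))\<^sup>2 \<le> (norm (T e))\<^sup>2 + (norm (T e) * norm x)\<^sup>2 * (norm t)\<^sup>2"
    by (simp add: power_mult_distrib nrm add smult algebra_simps)
qed

lemma (in hilbert_space) orthonormal_family_iff:
  "inj_on e I \<and> orthonormal H (e ` I) \<longleftrightarrow> (\<forall>i\<in>I. \<forall>j\<in>I. ip H (e i) (e j) = (if i = j then 1 else 0))"
proof (intro iffI conjI)
  assume R: "\<forall>i\<in>I. \<forall>j\<in>I. ip H (e i) (e j) = (if i = j then 1 else 0)"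
  show "inj_on e I"
  proof (rule inj_onI)
    fix i j assume "i \<in> I" "j \<in> I" "e i = e j"
    then have "(if i = j then 1 else 0) = (1::'k)" using R by metis
    then show "i = j" by (metis zero_neq_one)
  qed
  then show "orthonormal H (e ` I)" using R by (auto simp: orthonormal_def inj_on_eq_iff)
qed (auto simp: orthonormal_def inj_on_eq_iff)

section \<open>Existence of a singular value decomposition by deflation\<close>

context hilbert_schmidt_operator
begin

definition top_vector :: "('a \<Rightarrow> 'b) \<Rightarrow> 'a"
  where "top_vector S = (SOME e. (\<forall>x. norm (S x) \<le> norm (S e) * norm x) \<and> (S e \<noteq> 0 \<longrightarrow> norm e = 1))"

definition deflate :: "('a \<Rightarrow> 'b) \<Rightarrow> ('a \<Rightarrow> 'b)"
  where "deflate S = (\<lambda>x. S (x - smult H (ip H x (top_vector S)) (top_vector S)))"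

text \<open>Each step removes one term of the decomposition: \<open>deflate\<close> composes with the projection onto the
  orthogonal complement of a maximizer.\<close>

theorem ex_svd: "\<exists>\<sigma> e f. is_svd H K T \<sigma> e f"
proof -
  define S where "S n = (deflate ^^ n) T" for n
  define e where "e n = top_vector (S n)" for n
  define \<sigma> where "\<sigma> n = norm (S n (e n))" for n
  define f where "f n = smult K (of_real (1 / \<sigma> n)) (S n (e n))" for n
  have S0: "S 0 = T" by (simp add: S_def)
  have S_Suc: "S (Suc n) x = S n (x - smult H (ip H x (e n)) (e n))" for n x
    by (simp add: S_def deflate_def e_def)
  have op: "hilbert_schmidt_operator H K (S n)" for n
  proof (induction n)
    case 0
    show ?case using hilbert_schmidt_operator_axioms by (simp add: S0)
  next
    case (Suc n)
    interpret Sn: hilbert_schmidt_operator H K "S n" by (rule Suc)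
    \<comment> \<open>Deflation subtracts a rank-one operator, so the Hilbert-Schmidt property
      survives and a maximizer exists again.\<close>
    have "S (Suc n) = (\<lambda>x. S n x - smult K (ip H x (e n)) (S n (e n)))"
      by (simp add: S_Suc Sn.diff Sn.smult fun_eq_iff)
    then show ?case
      using Sn.bounded_ops_diff[OF bounded_ops_rank_one, of "e n" "S n (e n)"]
        hilbert_schmidt_diff[OF Sn.hilbert_schmidt hilbert_schmidt_rank_one, of "e n" "S n (e n)"]
      by unfold_locales auto
  qed
  interpret S: hilbert_schmidt_operator H K "S n" for n by (rule op)
  have "(\<forall>x. norm (S n x) \<le> norm (S n (e n)) * norm x) \<and> (S n (e n) \<noteq> 0 \<longrightarrow> norm (e n) = 1)" for n
    unfolding e_def top_vector_def by (rule someI_ex[OF S.ex_maximizer])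
  then have max: "norm (S n x) \<le> \<sigma> n * norm x" and e1: "\<sigma> n \<noteq> 0 \<Longrightarrow> norm (e n) = 1" for n x
    by (auto simp: \<sigma>_def)
  have \<sigma>_nonneg: "\<sigma> n \<ge> 0" for n by (simp add: \<sigma>_def)
  have perp: "x - smult H (ip H x (e n)) (e n) \<in> orth H {e n}" if "\<sigma> n \<noteq> 0" for n x
    using e1[OF that] by (auto simp: orth_def dom.ip_simps dom.ip_self)
  have S_Suc': "S (Suc n) x = S n x - smult K (ip H x (e n)) (S n (e n))" for n x
    by (simp add: S_Suc S.diff S.smult)
  have im_orth: "ip K (S n (e n)) (S (Suc n) x) = 0" for n x
  proof (cases "\<sigma> n = 0")
    case False
    show ?thesis unfolding S_Suc
      by (rule S.maximizer_image_orth) (use max e1 False perp in \<open>auto simp: \<sigma>_def\<close>)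
  qed (simp add: \<sigma>_def)
  have decr: "\<sigma> (Suc n) \<le> \<sigma> n" for n
  proof (cases "\<sigma> (Suc n) = 0 \<or> \<sigma> n = 0")
    case True
    then show ?thesis
    proof
      assume "\<sigma> n = 0"
      then have "S n x = 0" for x using max[of n x] by simp
      then show ?thesis by (simp add: \<sigma>_def S_Suc)
    qed (simp add: \<sigma>_nonneg)
  next
    case False
    let ?x = "e (Suc n)"
    have on: "orthonormal H {e n}"
      using e1 False dom.ip_self_unit by (auto simp: orthonormal_def)
    have "(norm (?x - smult H (ip H ?x (e n)) (e n)))\<^sup>2 \<le> (norm ?x)\<^sup>2"
      using dom.norm_fproj_decomp[OF _ on, of ?x] by (simp add: dom.fproj_def)
    then have "norm (?x - smult H (ip H ?x (e n)) (e n)) \<le> 1"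
      using e1[of "Suc n"] False by (metis norm_ge_zero power2_le_imp_le)
    then have "\<sigma> n * norm (?x - smult H (ip H ?x (e n)) (e n)) \<le> \<sigma> n * 1"
      by (intro mult_left_mono \<sigma>_nonneg)
    then show ?thesis
      using max[of n "?x - smult H (ip H ?x (e n)) (e n)"] by (simp add: \<sigma>_def S_Suc)
  qed
  have dec: "decseq \<sigma>" using decr by (rule decseq_SucI)
  \<comment> \<open>If \<open>S n x = 0\<close>, then \<open>S (Suc n) x\<close> is a multiple of
    \<open>S n (e n)\<close> and by \<open>im_orth\<close> also orthogonal to it, so the coefficient
    vanishes.\<close>
  have ker: "ip H x (e n) = 0" if "S n x = 0" "\<sigma> n \<noteq> 0" for n x
  proof -
    have "ip K (S n (e n)) (smult K (ip H x (e n)) (S n (e n))) = 0"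
      using im_orth[of n x] unfolding S_Suc' cod.ip_diff_right that(1) by simp
    then show ?thesis using that(2) by (simp add: cod.ip_smult_right \<sigma>_def)
  qed
  have killed: "S n (e i) = 0" if "i < n" "\<sigma> i \<noteq> 0" for i n
    using that(1)
  proof (induction n)
    case (Suc n)
    show ?case
    proof (cases "i = n")
      case True
      then show ?thesis
        using dom.ip_self_unit[OF e1[OF that(2)]] by (simp add: S_Suc S.zero)
    next
      case False
      then have "S n (e i) = 0" using Suc by simp
      moreover have "smult K (ip H (e i) (e n)) (S n (e n)) = 0"
        using ker[OF \<open>S n (e i) = 0\<close>] by (cases "\<sigma> n = 0") (auto simp: \<sigma>_def)
      ultimately show ?thesis by (simp add: S_Suc')
    qed
  qed simp
  have e_less: "ip H (e i) (e n) = 0" if "i < n" "\<sigma> i \<noteq> 0" "\<sigma> n \<noteq> 0" for i n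
    using ker killed that by blast
  have e_on: "ip H (e i) (e j) = (if i = j then 1 else 0)" if "\<sigma> i \<noteq> 0" "\<sigma> j \<noteq> 0" for i j
    using e_less[of i j] e_less[of j i] that dom.ip_self_unit[OF e1] dom.ip_eq_0_commute
    by (metis linorder_less_linear)
  \<comment> \<open>Later operators factor through earlier ones, so \<open>im_orth\<close> extends
    from consecutive steps to all later ones.\<close>
  have rng: "\<exists>y. S m x = S (Suc n) y" if "n < m" for n m x
    using that
  proof (induction m arbitrary: x)
    case (Suc m)
    then show ?case by (cases "n = m") (use S_Suc in \<open>auto simp: less_Suc_eq\<close>)
  qed simp
  have S_less: "ip K (S n (e n)) (S m x) = 0" if "n < m" for n m x
    using rng[OF that, of x] im_orth by metis
  have f_on: "ip K (f i) (f j) = (if i = j then 1 else 0)" if "\<sigma> i \<noteq> 0" "\<sigma> j \<noteq> 0" for i j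
  proof (cases "i = j")
    case True
    have "norm (f i) = 1"
      using that(1) cod.normalize_unit[of "S i (e i)"] by (simp add: f_def \<sigma>_def)
    then show ?thesis using True by (simp add: cod.ip_self_unit)
  next
    case False
    then have "ip K (S i (e i)) (S j (e j)) = 0"
      using S_less[of i j] S_less[of j i] cod.ip_eq_0_commute by (metis linorder_less_linear)
    then show ?thesis using False by (simp add: f_def cod.ip_simps)
  qed
  have f_scale: "smult K (of_real (\<sigma> n) * ip H x (e n)) (f n) = smult K (ip H x (e n)) (S n (e n))" for n x
    by (cases "\<sigma> n = 0") (auto simp: f_def \<sigma>_def)
  have partial: "(\<Sum>i<n. smult K (of_real (\<sigma> i) * ip H x (e i)) (f i)) = T x - S n x" for n x
  proof (induction n)
    case (Suc n)
    then show ?case by (simp add: f_scale S_Suc')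
  qed (simp add: S0)
  have T_e: "norm (T (e i)) = \<sigma> i" if "\<sigma> i \<noteq> 0" for i
  proof -
    have "smult K (of_real (\<sigma> j) * ip H (e i) (e j)) (f j) = 0" if "j < i" for j
      using e_on[of i j] that \<open>\<sigma> i \<noteq> 0\<close> by (cases "\<sigma> j = 0") auto
    then have "T (e i) - S i (e i) = 0" unfolding partial[symmetric] by (intro sum.neutral) auto
    then show ?thesis by (simp add: \<sigma>_def)
  qed
  obtain c where c: "\<And>F. finite F \<Longrightarrow> orthonormal H F \<Longrightarrow> (\<Sum>f\<in>F. (norm (T f))\<^sup>2) \<le> c"
    using hilbert_schmidt unfolding hilbert_schmidt_def by blast
  have "c \<ge> 0" using c[of "{}"] by simp
  \<comment> \<open>The orthonormal vectors \<open>e 0\<close> to \<open>e (n - 1)\<close> have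
    images of norm at least \<open>\<sigma> n\<close>, so \<open>n\<close> times its square is below
    the Hilbert-Schmidt bound.\<close>
  have bnd: "(\<sigma> n)\<^sup>2 \<le> c / real n" if "n > 0" for n
  proof (cases "\<sigma> n = 0")
    case True
    then show ?thesis using \<open>c \<ge> 0\<close> by simp
  next
    case False
    have nz: "\<sigma> i \<noteq> 0" if "i < n" for i
      using decseqD[OF dec, of i n] that False \<sigma>_nonneg[of n] by force
    then have "inj_on e {..<n} \<and> orthonormal H (e ` {..<n})"
      unfolding dom.orthonormal_family_iff using e_on by blast
    then have inj: "inj_on e {..<n}" and on: "orthonormal H (e ` {..<n})" by auto
    have "(\<Sum>i<n. (\<sigma> n)\<^sup>2) \<le> (\<Sum>i<n. (norm (T (e i)))\<^sup>2)"
      using T_e nz \<sigma>_nonneg decseqD[OF dec] by (intro sum_mono) (auto intro!: power_mono)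
    also have "\<dots> = (\<Sum>u\<in>e ` {..<n}. (norm (T u))\<^sup>2)" by (simp add: sum.reindex[OF inj])
    also have "\<dots> \<le> c" by (intro c on) simp
    finally show ?thesis using that by (simp add: field_simps)
  qed
  have \<sigma>0: "\<sigma> \<longlonglongrightarrow> 0"
  proof (rule tendsto_sandwich[of "\<lambda>_. 0" _ _ "\<lambda>n. sqrt (c * (1 / real n))"])
    show "\<forall>\<^sub>F n in sequentially. \<sigma> n \<le> sqrt (c * (1 / real n))"
      using eventually_gt_at_top[of 0] by eventually_elim (use bnd in \<open>auto intro!: real_le_rsqrt\<close>)
    have "(\<lambda>n. sqrt (c * (1 / real n))) \<longlonglongrightarrow> sqrt (c * 0)"
      by (intro tendsto_intros lim_1_over_n)
    then show "(\<lambda>n. sqrt (c * (1 / real n))) \<longlonglongrightarrow> 0" by simp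
  qed (auto simp: \<sigma>_nonneg)
  have "(\<lambda>i. smult K (of_real (\<sigma> i) * ip H x (e i)) (f i)) sums T x" for x
  proof -
    have "(\<lambda>n. \<sigma> n * norm x) \<longlonglongrightarrow> 0 * norm x" by (intro tendsto_intros \<sigma>0)
    then have "(\<lambda>n. \<sigma> n * norm x) \<longlonglongrightarrow> 0" by simp
    with always_eventually[OF allI[OF max]] have "(\<lambda>n. S n x) \<longlonglongrightarrow> 0"
      by (rule Lim_null_comparison)
    from tendsto_diff[OF tendsto_const this, of "T x"]
    show ?thesis by (simp add: sums_def partial)
  qed
  moreover have "inj_on e {i. \<sigma> i \<noteq> 0} \<and> orthonormal H (e ` {i. \<sigma> i \<noteq> 0})"
    unfolding dom.orthonormal_family_iff using e_on by simp
  moreover have "inj_on f {i. \<sigma> i \<noteq> 0} \<and> orthonormal K (f ` {i. \<sigma> i \<noteq> 0})"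
    unfolding cod.orthonormal_family_iff using f_on by simp
  ultimately have "is_svd H K T \<sigma> e f"
    unfolding is_svd_def using dec \<sigma>0 by blast
  then show ?thesis by blast
qed

end

section \<open>Singular vectors of a given decomposition, and gluing of decompositions\<close>

locale svd = dom: hilbert_space H + cod: hilbert_space K
  for H :: "('k::rc_scalar, 'a::banach) hilbert" and K :: "('k, 'b::banach) hilbert" +
  fixes T :: "'a \<Rightarrow> 'b" and \<sigma> :: "nat \<Rightarrow> real" and e f
  assumes is_svd: "is_svd H K T \<sigma> e f"
begin

lemma decseq: "decseq \<sigma>"
  and tendsto: "\<sigma> \<longlonglongrightarrow> 0"
  and sums: "(\<lambda>i. smult K (of_real (\<sigma> i) * ip H x (e i)) (f i)) sums T x"
  using is_svd by (auto simp: is_svd_def)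

lemma nonneg: "\<sigma> i \<ge> 0"
  using decseq tendsto by (rule decseq_ge)

lemma ip_e: "\<sigma> i \<noteq> 0 \<Longrightarrow> \<sigma> j \<noteq> 0 \<Longrightarrow> ip H (e i) (e j) = (if i = j then 1 else 0)"
  and ip_f: "\<sigma> i \<noteq> 0 \<Longrightarrow> \<sigma> j \<noteq> 0 \<Longrightarrow> ip K (f i) (f j) = (if i = j then 1 else 0)"
  using is_svd dom.orthonormal_family_iff[of e "{i. \<sigma> i \<noteq> 0}"]
    cod.orthonormal_family_iff[of f "{i. \<sigma> i \<noteq> 0}"]
  unfolding is_svd_def by simp_all

lemma norm_e: "\<sigma> i \<noteq> 0 \<Longrightarrow> norm (e i) = 1"
  using is_svd dom.orthonormal_norm unfolding is_svd_def by blast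

lemma norm_f: "\<sigma> i \<noteq> 0 \<Longrightarrow> norm (f i) = 1"
  using is_svd cod.orthonormal_norm unfolding is_svd_def by blast

lemma apply_e:
  assumes "\<sigma> i \<noteq> 0"
  shows "T (e i) = smult K (of_real (\<sigma> i)) (f i)"
proof -
  have "smult K (of_real (\<sigma> j) * ip H (e i) (e j)) (f j) =
      (if j = i then smult K (of_real (\<sigma> i)) (f i) else 0)" for j
    using ip_e[OF assms, of j] assms by (cases "\<sigma> j = 0") auto
  then have "(\<lambda>j. if j = i then smult K (of_real (\<sigma> i)) (f i) else 0) sums T (e i)"
    using sums[of "e i"] by simp
  then show ?thesis
    using sums_unique2 sums_single[of i "\<lambda>_. smult K (of_real (\<sigma> i)) (f i)"] by blast
qed

lemma ip_f_right:
  assumes "\<sigma> i \<noteq> 0"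
  shows "ip K (T x) (f i) = of_real (\<sigma> i) * ip H x (e i)"
proof -
  have "(\<lambda>j. ip K (smult K (of_real (\<sigma> j) * ip H x (e j)) (f j)) (f i)) sums ip K (T x) (f i)"
    by (rule bounded_linear.sums[OF cod.bounded_linear_ip_left sums])
  moreover have "ip K (smult K (of_real (\<sigma> j) * ip H x (e j)) (f j)) (f i) =
      (if j = i then of_real (\<sigma> i) * ip H x (e i) else 0)" for j
    using ip_f[OF _ assms, of j] by (cases "\<sigma> j = 0") (auto simp: cod.ip_smult_left)
  ultimately show ?thesis
    using sums_unique2 sums_single[of i "\<lambda>_. of_real (\<sigma> i) * ip H x (e i)"] by simp
qed

text \<open>Used to locate singular vectors: those of the two parts in
  \<open>truncated_svd_fproj\<close> fall into the span of \<open>F\<close> and its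
  complement.\<close>

lemma ker_orth_e: "T x = 0 \<Longrightarrow> \<sigma> i \<noteq> 0 \<Longrightarrow> ip H x (e i) = 0"
  using ip_f_right[of i x] by simp

lemma eq_0_if_orth_e:
  assumes "\<And>i. \<sigma> i \<noteq> 0 \<Longrightarrow> ip H x (e i) = 0"
  shows "T x = 0"
proof -
  from assms have "(\<lambda>i. smult K (of_real (\<sigma> i) * ip H x (e i)) (f i)) = (\<lambda>i. 0)" by (intro ext) auto
  then show ?thesis using sums[of x] sums_unique2[OF sums_zero] by metis
qed

end

context hilbert_schmidt_operator
begin

text \<open>If \<open>F\<close> spans a subspace on which \<open>T\<close> is larger than on its orthogonal complement, and \<open>T\<close> maps
  the two to orthogonal subspaces, then a singular value decomposition of \<open>T\<close> arises by appending
  one of the complementary part to one of \<open>T \<circ> fproj F\<close>.\<close>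

theorem truncated_svd_fproj:
  assumes F: "finite F" "orthonormal H F" "card F \<le> r"
    and orth: "\<And>x y. x \<in> module.span (smult H) F \<Longrightarrow> y \<in> orth H F \<Longrightarrow> ip K (T x) (T y) = 0"
    and large: "\<And>x y. x \<in> module.span (smult H) F \<Longrightarrow> y \<in> orth H F \<Longrightarrow> norm x = 1 \<Longrightarrow> norm y = 1 \<Longrightarrow>
      norm (T y) \<le> norm (T x)"
    and full: "\<And>y. card F < r \<Longrightarrow> y \<in> orth H F \<Longrightarrow> T y = 0"
  shows "is_truncated_svd H K r T (T \<circ> dom.fproj F)"
proof -
  define S1 where "S1 = (\<lambda>x. T (dom.fproj F x))"
  define S2 where "S2 = (\<lambda>x. T x - S1 x)"
  have S1_sum: "S1 = (\<lambda>x. \<Sum>f\<in>F. smult K (ip H x f) (T f))"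
    by (simp add: S1_def dom.fproj_def sum smult)
  have S2: "hilbert_schmidt_operator H K (\<lambda>x. T x - (\<Sum>f\<in>G. smult K (ip H x f) (T f)))"
    if "finite G" for G
    using that
  proof (induction G rule: finite_induct)
    case empty
    then show ?case using hilbert_schmidt_operator_axioms by simp
  next
    case (insert g G)
    interpret S: hilbert_schmidt_operator H K "\<lambda>x. T x - (\<Sum>f\<in>G. smult K (ip H x f) (T f))"
      by (rule insert.IH)
    show ?case
      using S.bounded_ops_diff[OF bounded_ops_rank_one, of g "T g"] insert(1,2)
        hilbert_schmidt_diff[OF S.hilbert_schmidt hilbert_schmidt_rank_one, of g "T g"]
      by unfold_locales (simp_all add: algebra_simps)
  qed
  interpret S2: hilbert_schmidt_operator H K S2
    using S2[OF F(1)] by (simp add: S2_def S1_sum)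
  have "(\<lambda>x. T x - S2 x) = S1" by (simp add: S2_def)
  then interpret S1: hilbert_schmidt_operator H K S1
    using bounded_ops_diff[OF S2.bounded_ops] hilbert_schmidt_diff[OF hilbert_schmidt S2.hilbert_schmidt]
    by unfold_locales simp_all
  obtain \<sigma>1 e1 f1 where 1: "is_svd H K S1 \<sigma>1 e1 f1" using S1.ex_svd by blast
  obtain \<sigma>2 e2 f2 where 2: "is_svd H K S2 \<sigma>2 e2 f2" using S2.ex_svd by blast
  interpret svd1: svd H K S1 \<sigma>1 e1 f1 by unfold_locales (rule 1)
  interpret svd2: svd H K S2 \<sigma>2 e2 f2 by unfold_locales (rule 2)
  have fproj_orth: "dom.fproj F x = 0" if "x \<in> orth H F" for x
    using that dom.vs.span_zero by (intro dom.fproj_eqI F(1,2)) simp_all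
  have orth_S: "orth H (dom.vs.span F) = orth H F" by (rule dom.orth_span)
  have oo: "orth H (orth H F) = dom.vs.span F"
    using dom.orth_orth_closed[OF dom.vs.subspace_span dom.closed_span_orthonormal[OF F(1,2)]]
    by (simp add: orth_S)
  have e1: "e1 i \<in> dom.vs.span F" if "\<sigma>1 i \<noteq> 0" for i
  proof -
    have "ip H x (e1 i) = 0" if "x \<in> orth H F" for x
      by (rule svd1.ker_orth_e) (use fproj_orth[OF that] \<open>\<sigma>1 i \<noteq> 0\<close> in \<open>auto simp: S1_def zero\<close>)
    then have "e1 i \<in> orth H (orth H F)" by (auto simp: orth_def[of H "orth H F"] dom.ip_eq_0_commute[of "e1 i"])
    then show ?thesis by (simp add: oo)
  qed
  have e2: "e2 i \<in> orth H F" if "\<sigma>2 i \<noteq> 0" for i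
  proof -
    have "ip H x (e2 i) = 0" if "x \<in> dom.vs.span F" for x
      by (rule svd2.ker_orth_e)
        (use dom.fproj_id[OF F(1,2) that] \<open>\<sigma>2 i \<noteq> 0\<close> in \<open>auto simp: S2_def S1_def\<close>)
    then have "e2 i \<in> orth H (dom.vs.span F)" by (auto simp: orth_def dom.ip_eq_0_commute[of "e2 i"])
    then show ?thesis by (simp add: orth_S)
  qed
  have T_e1: "T (e1 i) = smult K (of_real (\<sigma>1 i)) (f1 i)" if "\<sigma>1 i \<noteq> 0" for i
    using svd1.apply_e[OF that] dom.fproj_id[OF F(1,2) e1[OF that]] by (simp add: S1_def)
  have T_e2: "T (e2 i) = smult K (of_real (\<sigma>2 i)) (f2 i)" if "\<sigma>2 i \<noteq> 0" for i
    using svd2.apply_e[OF that] fproj_orth[OF e2[OF that]] by (simp add: S2_def S1_def zero)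
  have e12: "ip H (e1 i) (e2 j) = 0" if "\<sigma>1 i \<noteq> 0" "\<sigma>2 j \<noteq> 0" for i j
    using dom.orthD'[of "e2 j" "dom.vs.span F" "e1 i"] e1 e2 that by (simp add: orth_S)
  have f12: "ip K (f1 i) (f2 j) = 0" if "\<sigma>1 i \<noteq> 0" "\<sigma>2 j \<noteq> 0" for i j
    using orth[OF e1 e2, OF that] that by (simp add: T_e1 T_e2 cod.ip_simps)
  \<comment> \<open>By monotonicity a nonzero value here would give \<open>i + 1\<close> orthonormal
    vectors in the span of \<open>F\<close>.\<close>
  have small: "\<sigma>1 i = 0" if "card F \<le> i" for i
  proof (rule ccontr)
    assume nz: "\<sigma>1 i \<noteq> 0"
    have "\<sigma>1 j \<noteq> 0" if "j \<le> i" for j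
      using decseqD[OF svd1.decseq that] nz svd1.nonneg[of i] by linarith
    then have "inj_on e1 {..i} \<and> orthonormal H (e1 ` {..i})" "e1 ` {..i} \<subseteq> dom.vs.span F"
      unfolding dom.orthonormal_family_iff using svd1.ip_e e1 by auto
    then have "card {..i} \<le> card F"
      using dom.vs.independent_span_bound[OF F(1) dom.orthonormal_independent, of "e1 ` {..i}"]
      by (simp add: card_image)
    then show False using that by simp
  qed
  \<comment> \<open>The seam between the two decompositions. If \<open>\<sigma>2 0\<close> is
    nonzero, \<open>full\<close> forces \<open>card F = r\<close>.\<close>
  have step: "\<sigma>2 0 \<le> \<sigma>1 i" if "r = Suc i" for i
  proof (cases "\<sigma>2 0 = 0")
    case False
    have "T (e2 0) \<noteq> 0" using svd2.norm_f[OF False] False by (auto simp: T_e2)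
    then have card: "card F = Suc i" using full[OF _ e2[OF False]] F(3) that by fastforce
    have n2: "norm (T (e2 0)) = \<sigma>2 0"
      using False svd2.norm_f[OF False] svd2.nonneg[of 0] by (simp add: T_e2 cod.norm_smult)
    show ?thesis
    proof (cases "\<sigma>1 i = 0")
      case True
      \<comment> \<open>Fewer than \<open>card F\<close> of the vectors \<open>e1 j\<close> carry
        nonzero values, so some unit vector in the span of \<open>F\<close> is orthogonal to all of
        them and killed by \<open>T\<close>; \<open>large\<close> then gives
        \<open>\<sigma>2 0 \<le> 0\<close>.\<close>
      define E where "E = e1 ` {j. j < i \<and> \<sigma>1 j \<noteq> 0}"
      have "inj_on e1 {j. j < i \<and> \<sigma>1 j \<noteq> 0} \<and> orthonormal H E"
        unfolding E_def dom.orthonormal_family_iff using svd1.ip_e by auto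
      then have on: "orthonormal H E" by simp
      have fin: "finite E" and sub: "E \<subseteq> dom.vs.span F" by (auto simp: E_def e1)
      have "card E \<le> card {..<i}"
        unfolding E_def by (rule order_trans[OF card_image_le card_mono]) auto
      then have "\<not> F \<subseteq> dom.vs.span E"
        using dom.vs.independent_span_bound[OF fin dom.orthonormal_independent[OF F(1,2)]] card by auto
      then obtain x where x: "x \<in> F" "x \<notin> dom.vs.span E" by blast
      define w where "w = x - dom.fproj E x"
      have "w \<noteq> 0" using x(2) dom.fproj_in_span[of E x] by (auto simp: w_def)
      have "dom.fproj E x \<in> dom.vs.span F"
        using dom.vs.span_minimal[OF sub dom.vs.subspace_span] dom.fproj_in_span[of E x] by blast
      then have w: "w \<in> dom.vs.span F"
        unfolding w_def using dom.vs.span_diff[OF dom.vs.span_base[OF x(1)]] by blast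
      have "ip H w (e1 j) = 0" if "\<sigma>1 j \<noteq> 0" for j
      proof -
        have "j < i" using that True decseqD[OF svd1.decseq, of i j] svd1.nonneg[of j]
          by (cases "i \<le> j") auto
        then show ?thesis
          using that dom.orthD[OF dom.diff_fproj_orth[OF fin on, of x], of "e1 j"]
          by (auto simp: w_def E_def)
      qed
      then have "S1 w = 0" by (rule svd1.eq_0_if_orth_e)
      then have "T w = 0" using dom.fproj_id[OF F(1,2) w] by (simp add: S1_def)
      define u where "u = smult H (of_real (1 / norm w)) w"
      have u: "norm u = 1" "u \<in> dom.vs.span F" "T u = 0"
        using dom.normalize_unit[OF \<open>w \<noteq> 0\<close>] dom.vs.span_scale[OF w] \<open>T w = 0\<close>
        by (auto simp: u_def smult)
      have "norm (T (e2 0)) \<le> norm (T u)"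
        by (rule large[OF u(2) e2[OF False] u(1) svd2.norm_e[OF False]])
      then show ?thesis using n2 u(3) svd1.nonneg[of i] by simp
    next
      case nz: False
      have "norm (T (e1 i)) = \<sigma>1 i"
        using nz svd1.norm_f[OF nz] svd1.nonneg[of i] by (simp add: T_e1 cod.norm_smult)
      moreover have "norm (T (e2 0)) \<le> norm (T (e1 i))"
        by (rule large[OF e1[OF nz] e2[OF False] svd1.norm_e[OF nz] svd2.norm_e[OF False]])
      ultimately show ?thesis using n2 by simp
    qed
  qed (simp add: svd1.nonneg)
  define \<sigma> where "\<sigma> i = (if i < r then \<sigma>1 i else \<sigma>2 (i - r))" for i
  define e where "e i = (if i < r then e1 i else e2 (i - r))" for i
  define f where "f i = (if i < r then f1 i else f2 (i - r))" for i
  have trunc: "S1 x = (\<Sum>i<r. smult K (of_real (\<sigma> i) * ip H x (e i)) (f i))" for x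
  proof -
    have "(\<lambda>i. smult K (of_real (\<sigma>1 i) * ip H x (e1 i)) (f1 i)) sums
        (\<Sum>i<r. smult K (of_real (\<sigma>1 i) * ip H x (e1 i)) (f1 i))"
      using small F(3) by (intro sums_finite) auto
    then have "S1 x = (\<Sum>i<r. smult K (of_real (\<sigma>1 i) * ip H x (e1 i)) (f1 i))"
      using svd1.sums[of x] sums_unique2 by blast
    then show ?thesis by (simp add: \<sigma>_def e_def f_def)
  qed
  have "is_svd H K T \<sigma> e f"
    unfolding is_svd_def
  proof (intro conjI allI)
    show "decseq \<sigma>"
    proof (rule decseq_SucI)
      fix i
      consider "Suc i < r" | "Suc i = r" | "r \<le> i" by linarith
      then show "\<sigma> (Suc i) \<le> \<sigma> i"
        using step[of i] decseqD[OF svd1.decseq, of i "Suc i"] decseqD[OF svd2.decseq, of "i - r" "Suc i - r"]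
        by cases (auto simp: \<sigma>_def)
    qed
    show "\<sigma> \<longlonglongrightarrow> 0"
      by (rule LIMSEQ_offset[where k = r]) (use svd2.tendsto in \<open>simp add: \<sigma>_def\<close>)
    have "ip H (e i) (e j) = (if i = j then 1 else 0)" if "\<sigma> i \<noteq> 0" "\<sigma> j \<noteq> 0" for i j
      using that svd1.ip_e[of i j] svd2.ip_e[of "i - r" "j - r"] e12[of i "j - r"] e12[of j "i - r"]
        dom.ip_eq_0_commute[of "e1 j" "e2 (i - r)"]
      by (auto simp: \<sigma>_def e_def split: if_splits)
    then have "inj_on e {i. \<sigma> i \<noteq> 0} \<and> orthonormal H (e ` {i. \<sigma> i \<noteq> 0})"
      unfolding dom.orthonormal_family_iff by simp
    then show "inj_on e {i. \<sigma> i \<noteq> 0}" "orthonormal H (e ` {i. \<sigma> i \<noteq> 0})" by blast+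
    have "ip K (f i) (f j) = (if i = j then 1 else 0)" if "\<sigma> i \<noteq> 0" "\<sigma> j \<noteq> 0" for i j
      using that svd1.ip_f[of i j] svd2.ip_f[of "i - r" "j - r"] f12[of i "j - r"] f12[of j "i - r"]
        cod.ip_eq_0_commute[of "f1 j" "f2 (i - r)"]
      by (auto simp: \<sigma>_def f_def split: if_splits)
    then have "inj_on f {i. \<sigma> i \<noteq> 0} \<and> orthonormal K (f ` {i. \<sigma> i \<noteq> 0})"
      unfolding cod.orthonormal_family_iff by simp
    then show "inj_on f {i. \<sigma> i \<noteq> 0}" "orthonormal K (f ` {i. \<sigma> i \<noteq> 0})" by blast+
    fix x
    have "(\<lambda>i. smult K (of_real (\<sigma> (i + r)) * ip H x (e (i + r))) (f (i + r))) sums S2 x"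
      using svd2.sums[of x] by (simp add: \<sigma>_def e_def f_def)
    then show "(\<lambda>i. smult K (of_real (\<sigma> i) * ip H x (e i)) (f i)) sums T x"
      using sums_iff_shift[of "\<lambda>i. smult K (of_real (\<sigma> i) * ip H x (e i)) (f i)" r "S2 x"]
      unfolding trunc[symmetric] by (simp add: S2_def)
  qed
  then show ?thesis
    unfolding is_truncated_svd_def o_def using trunc by (auto simp: S1_def fun_eq_iff)
qed

end

section \<open>Best approximation in the Hilbert--Schmidt norm\<close>

context bounded_operator
begin

text \<open>Parseval's identity for each adjoint image, summed over \<open>F\<close>: it trades an
  infinite sum over a basis of the domain for a finite one in the codomain.\<close>

lemma parseval_adj:
  assumes "is_onb H E" "finite F"
  shows "((\<lambda>e. \<Sum>f\<in>F. (norm (ip K (T e) f))\<^sup>2) has_sum (\<Sum>f\<in>F. (norm (adj H K T f))\<^sup>2)) E"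
  using assms(2)
proof (induction F rule: finite_induct)
  case (insert g F)
  have "((\<lambda>e. (norm (ip K (T e) g))\<^sup>2) has_sum (norm (adj H K T g))\<^sup>2) E"
    using dom.parseval[OF assms(1), of "adj H K T g"]
    by (simp add: ip_adj dom.norm_ip_commute[of _ "adj H K T g"])
  from has_sum_add[OF this insert.IH] show ?case using insert(1,2) by simp
qed simp

lemma hilbert_schmidt_adj_of_summable:
  assumes "is_onb H E" "(\<lambda>e. (norm (T e))\<^sup>2) summable_on E"
  shows "hilbert_schmidt K H (adj H K T)"
  unfolding hilbert_schmidt_def
proof (intro exI allI impI)
  fix F assume F: "finite F" "orthonormal K F"
  show "(\<Sum>f\<in>F. (norm (adj H K T f))\<^sup>2) \<le> (\<Sum>\<^sub>\<infinity>e\<in>E. (norm (T e))\<^sup>2)"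
    by (rule has_sum_mono[OF parseval_adj[OF assms(1) F(1)] has_sum_infsum[OF assms(2)]])
      (rule cod.bessel[OF F])
qed

lemma summable_of_hilbert_schmidt:
  assumes "hilbert_schmidt H K T" "orthonormal H E"
  shows "(\<lambda>e. (norm (T e))\<^sup>2) summable_on E"
proof (rule nonneg_bdd_above_summable_on)
  obtain c where "\<And>F. finite F \<Longrightarrow> orthonormal H F \<Longrightarrow> (\<Sum>f\<in>F. (norm (T f))\<^sup>2) \<le> c"
    using assms(1) unfolding hilbert_schmidt_def by blast
  then show "bdd_above (sum (\<lambda>e. (norm (T e))\<^sup>2) ` {F. F \<subseteq> E \<and> finite F})"
    using dom.orthonormal_mono[OF assms(2)] by (intro bdd_aboveI2[of _ _ c]) auto
qed simp

lemma hilbert_schmidt_adj: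
  assumes "hilbert_schmidt H K T"
  shows "hilbert_schmidt K H (adj H K T)"
  by (rule hilbert_schmidt_adj_of_summable[OF dom.is_onb_some_onb])
    (rule summable_of_hilbert_schmidt[OF assms dom.orthonormal_some_onb])

end

text \<open>Two passages to the adjoint: summability over one basis bounds the adjoint on all finite
  orthonormal sets, and doing the same for the adjoint returns to \<open>T\<close>. This frees the
  argument from the chosen basis.\<close>

lemma hs_ops_hilbert_schmidt:
  assumes "hilbert_space H" "hilbert_space K" "T \<in> hs_ops H K"
  shows "hilbert_schmidt_operator H K T"
proof -
  interpret bounded_operator H K T
    using assms by (auto simp: bounded_operator_def bounded_operator_axioms_def hs_ops_def)
  have "hilbert_schmidt K H (adj H K T)"
    using assms(3) by (intro hilbert_schmidt_adj_of_summable[OF dom.is_onb_some_onb]) (simp add: hs_ops_def)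
  then show ?thesis
    using adj.hilbert_schmidt_adj by unfold_locales simp
qed

section \<open>Range, trace and adjoint of a best approximation\<close>

locale best_approximation = hilbert_schmidt_operator H K T
  for H :: "('k::rc_scalar, 'a::banach) hilbert" and K :: "('k, 'b::banach) hilbert" and T +
  fixes Y :: "'a \<Rightarrow> 'b" and r :: nat
  assumes rank_le: "Y \<in> rank_le_ops H K r"
    and minimal: "Y' \<in> rank_le_ops H K r \<Longrightarrow>
      hs_norm H (\<lambda>x. T x - Y x) \<le> hs_norm H (\<lambda>x. T x - Y' x)"
begin

sublocale Y: bounded_operator H K Y
  using rank_le by unfold_locales (simp add: rank_le_ops_def)

lemma dim_le: "cod.vs.dim (range Y) \<le> r"
  using rank_le by (simp add: rank_le_ops_def)

lemma fin_range: "\<exists>b. finite b \<and> range Y \<subseteq> cod.vs.span b"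
  using rank_le by (auto simp: rank_le_ops_def)

lemma hilbert_schmidt_Y: "hilbert_schmidt H K Y"
proof -
  obtain F where F: "finite F" "orthonormal K F" "cod.vs.span F = range Y"
    using cod.ex_orthonormal_basis[OF Y.subspace_range] fin_range by metis
  have Y: "(norm (Y x))\<^sup>2 = (\<Sum>f\<in>F. (norm (ip H (adj H K Y f) x))\<^sup>2)" for x
    using cod.norm_fproj[OF F(1,2), of "Y x"] cod.fproj_id[OF F(1,2), of "Y x"] F(3)
    by (simp add: Y.ip_adj dom.norm_ip_commute[of x])
  have "(\<Sum>x\<in>G. (norm (Y x))\<^sup>2) \<le> (\<Sum>f\<in>F. (norm (adj H K Y f))\<^sup>2)"
    if "finite G" "orthonormal H G" for G
    unfolding Y by (subst sum.swap) (intro sum_mono dom.bessel that)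
  then show ?thesis unfolding hilbert_schmidt_def by blast
qed

lemma bounded_ops_fproj:
  assumes "finite G" "orthonormal K G"
  shows "(\<lambda>x. cod.fproj G (T x)) \<in> bounded_ops H K"
proof -
  obtain c where c: "\<And>x. norm (T x) \<le> c * norm x" using bounded by blast
  show ?thesis
  proof (rule bounded_opsI[where c = c])
    fix x
    have "(norm (cod.fproj G (T x)))\<^sup>2 \<le> (norm (T x))\<^sup>2"
      using cod.bessel[OF assms] by (simp add: cod.norm_fproj[OF assms])
    then have "norm (cod.fproj G (T x)) \<le> norm (T x)" by (rule power2_le_imp_le) simp
    then show "norm (cod.fproj G (T x)) \<le> c * norm x" using c[of x] by linarith
  qed (auto simp: add smult cod.fproj_add cod.fproj_smult
      intro: dom.hilbert_space_axioms cod.hilbert_space_axioms)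
qed

lemma fproj_rank_le:
  assumes "finite G" "orthonormal K G" "card G \<le> r"
  shows "(\<lambda>x. cod.fproj G (T x)) \<in> rank_le_ops H K r"
proof -
  have sub: "range (\<lambda>x. cod.fproj G (T x)) \<subseteq> cod.vs.span G" using cod.fproj_in_span by auto
  from cod.vs.dim_le_card[OF sub assms(1)] show ?thesis
    unfolding rank_le_ops_def using assms sub bounded_ops_fproj[OF assms(1,2)] by auto
qed

lemma minimal_infsum:
  assumes "Y' \<in> rank_le_ops H K r"
  shows "(\<Sum>\<^sub>\<infinity>e\<in>some_onb H. (norm (T e - Y e))\<^sup>2) \<le> (\<Sum>\<^sub>\<infinity>e\<in>some_onb H. (norm (T e - Y' e))\<^sup>2)"
  using minimal[OF assms] by (simp add: hs_norm_def)

text \<open>An infinite sum over a non-summable family defaults to 0; summability is what gives the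
  left side of \<open>minimal_infsum\<close> its meaning as an error.\<close>

lemma summable_Y: "(\<lambda>e. (norm (T e - Y e))\<^sup>2) summable_on some_onb H"
  using bounded_operator.summable_of_hilbert_schmidt[OF _
      hilbert_schmidt_diff[OF hilbert_schmidt hilbert_schmidt_Y] dom.orthonormal_some_onb]
    bounded_ops_diff[OF Y.bounded_ops] dom.hilbert_space_axioms cod.hilbert_space_axioms
  by (simp add: bounded_operator_def bounded_operator_axioms_def)

text \<open>Pythagoras summed over the basis. Since the total is fixed, a smaller approximation
  error means a larger trace on the span of \<open>G\<close>.\<close>

lemma hs_norm_fproj:
  assumes G: "finite G" "orthonormal K G"
  shows "(\<lambda>e. (norm (T e - cod.fproj G (T e)))\<^sup>2) summable_on some_onb H" (is ?A)
    and "(\<Sum>\<^sub>\<infinity>e\<in>some_onb H. (norm (T e))\<^sup>2) =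
      (\<Sum>\<^sub>\<infinity>e\<in>some_onb H. (norm (T e - cod.fproj G (T e)))\<^sup>2) + (\<Sum>g\<in>G. (norm (adj H K T g))\<^sup>2)"
proof -
  have decomp: "(norm (T e))\<^sup>2 = (norm (T e - cod.fproj G (T e)))\<^sup>2 + (\<Sum>g\<in>G. (norm (ip K (T e) g))\<^sup>2)" for e
    by (rule cod.norm_fproj_decomp[OF G])
  have s: "(\<lambda>e. (norm (T e))\<^sup>2) summable_on some_onb H"
    by (rule summable_of_hilbert_schmidt[OF hilbert_schmidt dom.orthonormal_some_onb])
  show ?A
  proof (rule summable_on_comparison_test[OF s])
    show "(norm (T e - cod.fproj G (T e)))\<^sup>2 \<le> (norm (T e))\<^sup>2" for e
      using decomp[of e] by (simp add: sum_nonneg)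
  qed simp
  from has_sum_add[OF has_sum_infsum[OF this] parseval_adj[OF dom.is_onb_some_onb G(1)]]
  show "(\<Sum>\<^sub>\<infinity>e\<in>some_onb H. (norm (T e))\<^sup>2) =
      (\<Sum>\<^sub>\<infinity>e\<in>some_onb H. (norm (T e - cod.fproj G (T e)))\<^sup>2) + (\<Sum>g\<in>G. (norm (adj H K T g))\<^sup>2)"
    unfolding decomp[symmetric] by (rule infsumI)
qed

lemma Y_eq_fproj:
  assumes F: "finite F" "orthonormal K F" "cod.vs.span F = range Y"
  shows "Y = (\<lambda>x. cod.fproj F (T x))"
proof -
  have card: "card F \<le> r" using cod.dim_span_orthonormal[OF F(1,2)] dim_le by (simp add: F(3))
  have W: "(\<lambda>x. cod.fproj F (T x) - Y x) \<in> bounded_ops H K"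
    using bounded_operator.bounded_ops_diff[OF _ Y.bounded_ops] bounded_ops_fproj[OF F(1,2)]
      dom.hilbert_space_axioms cod.hilbert_space_axioms
    by (simp add: bounded_operator_def bounded_operator_axioms_def)
  then interpret W: bounded_operator H K "\<lambda>x. cod.fproj F (T x) - Y x"
    by unfold_locales
  have decomp: "(norm (T e - Y e))\<^sup>2 =
      (norm (T e - cod.fproj F (T e)))\<^sup>2 + (norm (cod.fproj F (T e) - Y e))\<^sup>2" for e
    using F by (intro cod.norm_diff_span) auto
  have s: "(\<lambda>e. (norm (cod.fproj F (T e) - Y e))\<^sup>2) summable_on some_onb H"
    by (rule summable_on_comparison_test[OF summable_Y]) (simp_all add: decomp)
  have "(\<Sum>\<^sub>\<infinity>e\<in>some_onb H. (norm (T e - Y e))\<^sup>2) =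
    (\<Sum>\<^sub>\<infinity>e\<in>some_onb H. (norm (T e - cod.fproj F (T e)))\<^sup>2) +
    (\<Sum>\<^sub>\<infinity>e\<in>some_onb H. (norm (cod.fproj F (T e) - Y e))\<^sup>2)"
    unfolding decomp by (rule infsum_add[OF hs_norm_fproj(1)[OF F(1,2)] s])
  then have "(\<Sum>\<^sub>\<infinity>e\<in>some_onb H. (norm (cod.fproj F (T e) - Y e))\<^sup>2) \<le> 0"
    using minimal_infsum[OF fproj_rank_le[OF F(1,2) card]] by linarith
  from nonneg_infsum_le_0D[OF this s] have "some_onb H \<subseteq> ker_op (\<lambda>x. cod.fproj F (T x) - Y x)"
    by (auto simp: ker_op_def)
  then have "dom.vs.span (some_onb H) \<subseteq> ker_op (\<lambda>x. cod.fproj F (T x) - Y x)"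
    by (rule dom.vs.span_minimal[OF _ W.subspace_ker])
  then have "closure (dom.vs.span (some_onb H)) \<subseteq> ker_op (\<lambda>x. cod.fproj F (T x) - Y x)"
    by (rule closure_minimal[OF _ W.closed_ker])
  then show ?thesis
    using dom.is_onb_some_onb by (auto simp: is_onb_def ker_op_def fun_eq_iff subset_iff)
qed

lemma trace_maximal:
  assumes F: "finite F" "orthonormal K F" "cod.vs.span F = range Y"
    and G: "finite G" "orthonormal K G" "card G \<le> r"
  shows "(\<Sum>g\<in>G. (norm (adj H K T g))\<^sup>2) \<le> (\<Sum>f\<in>F. (norm (adj H K T f))\<^sup>2)"
  using minimal_infsum[OF fproj_rank_le[OF G]] hs_norm_fproj(2)[OF F(1,2)] hs_norm_fproj(2)[OF G(1,2)]
  by (simp add: fun_cong[OF Y_eq_fproj[OF F]])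

text \<open>Replacing one basis vector \<open>x\<close> of the range by another unit vector orthogonal to the remaining
  ones must not increase the trace.\<close>

lemma
  assumes x: "x \<in> range Y" "norm x = 1" and y: "y \<in> orth K (range Y)"
  shows norm_adj_le: "norm y = 1 \<Longrightarrow> norm (adj H K T y) \<le> norm (adj H K T x)"
    and ip_adj_eq_0: "ip H (adj H K T x) (adj H K T y) = 0"
proof -
  obtain F0 where F0: "finite F0" "orthonormal K F0" "cod.vs.span F0 = range Y"
    using cod.ex_orthonormal_basis[OF Y.subspace_range] fin_range by metis
  have "orthonormal K {x}" using x(2) cod.ip_self_unit by (auto simp: orthonormal_def)
  then obtain F where F: "finite F" "orthonormal K F" "x \<in> F" "cod.vs.span F = cod.vs.span (insert x F0)"
    using cod.gram_schmidt[OF F0(1), of "{x}"] by auto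
  then have span: "cod.vs.span F = range Y"
    using F0(3) x(1) by (simp add: cod.vs.span_redundant)
  have card: "card F \<le> r" using cod.dim_span_orthonormal[OF F(1,2)] dim_le by (simp add: span)
  have unit: "norm (adj H K T z) \<le> norm (adj H K T x)" if z: "norm z = 1" "z \<in> orth K (F - {x})" for z
  proof -
    have "z \<notin> F - {x}" using cod.in_orth_self[OF _ z(2)] z(1) by (metis norm_zero zero_neq_one)
    moreover have "orthonormal K (insert z (F - {x}))"
      using cod.orthonormal_mono[OF F(2)] z by (intro cod.orthonormal_insert) auto
    moreover have "card (insert z (F - {x})) \<le> r"
      using card F(1,3) \<open>z \<notin> F - {x}\<close> card_Suc_Diff1[OF F(1,3)] by simp
    ultimately have "(norm (adj H K T z))\<^sup>2 + (\<Sum>f\<in>F - {x}. (norm (adj H K T f))\<^sup>2)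
        \<le> (\<Sum>f\<in>F. (norm (adj H K T f))\<^sup>2)"
      using trace_maximal[OF F(1,2) span, of "insert z (F - {x})"] F(1) by simp
    then have "(norm (adj H K T z))\<^sup>2 \<le> (norm (adj H K T x))\<^sup>2"
      using F(1,3) by (simp add: sum.remove)
    then show ?thesis by (rule power2_le_imp_le) simp
  qed
  \<comment> \<open>The perturbed vector \<open>x + smult K t y\<close> below is not a unit vector,
    so the exchange bound is needed in homogeneous form.\<close>
  have scaled: "norm (adj H K T z) \<le> norm (adj H K T x) * norm z" if z: "z \<in> orth K (F - {x})" for z
  proof (cases "z = 0")
    case False
    have "norm (adj H K T (smult K (of_real (1 / norm z)) z)) \<le> norm (adj H K T x)"
      using cod.normalize_unit[OF False] cod.vs.subspace_scale[OF cod.subspace_orth z] by (rule unit)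
    then show ?thesis using False
      by (simp add: adj.smult dom.norm_smult norm_divide divide_le_eq)
  qed (simp add: adj.zero)
  have "F \<subseteq> range Y" using cod.vs.span_superset[of F] by (simp add: span)
  then have y': "y \<in> orth K (F - {x})" using y cod.orth_antimono[of "F - {x}" "range Y"] by blast
  show "norm (adj H K T y) \<le> norm (adj H K T x)" if "norm y = 1" using unit[OF that y'] .
  have x': "x \<in> orth K (F - {x})" using F(2,3) by (auto simp: orth_def orthonormal_def)
  show "ip H (adj H K T x) (adj H K T y) = 0"
  proof (rule dom.ip_eq_0_if_maximal)
    fix t
    have "ip K x (smult K t y) = 0" using cod.orthD'[OF y x(1)] by (simp add: cod.ip_smult_right)
    then have nrm: "(norm (x + smult K t y))\<^sup>2 = 1 + (norm t * norm y)\<^sup>2"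
      using cod.pythagoras[of x "smult K t y"] x(2) by (simp add: cod.norm_smult)
    have "(norm (adj H K T (x + smult K t y)))\<^sup>2 \<le> (norm (adj H K T x) * norm (x + smult K t y))\<^sup>2"
      by (intro power_mono scaled cod.vs.subspace_add[OF cod.subspace_orth]
          cod.vs.subspace_scale[OF cod.subspace_orth] x' y') simp
    then show "(norm (adj H K T x + smult H t (adj H K T y)))\<^sup>2
        \<le> (norm (adj H K T x))\<^sup>2 + (norm (adj H K T x) * norm y)\<^sup>2 * (norm t)\<^sup>2"
      by (simp add: power_mult_distrib nrm adj.add adj.smult algebra_simps)
  qed
qed

lemma ip_adj_range_orth:
  assumes "x \<in> range Y" "y \<in> orth K (range Y)"
  shows "ip H (adj H K T x) (adj H K T y) = 0"
proof (cases "x = 0")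
  case False
  have "smult K (of_real (1 / norm x)) x \<in> range Y"
    using cod.vs.subspace_scale[OF Y.subspace_range assms(1)] .
  from ip_adj_eq_0[OF this cod.normalize_unit[OF False] assms(2)] show ?thesis
    using False by (simp add: adj.smult dom.ip_smult_left)
qed (simp add: adj.zero)

text \<open>With rank to spare, a unit vector can be added to the basis without dropping one, so
  maximality of the trace leaves it no contribution. This supplies \<open>full\<close> in
  \<open>truncated_svd_fproj\<close>.\<close>

lemma adj_orth_eq_0:
  assumes F: "finite F" "orthonormal K F" "cod.vs.span F = range Y" and "card F < r"
    and y: "y \<in> orth K (range Y)"
  shows "adj H K T y = 0"
proof (cases "y = 0")
  case False
  define u where "u = smult K (of_real (1 / norm y)) y"
  have "F \<subseteq> range Y" using cod.vs.span_superset[of F] by (simp add: F(3))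
  then have u: "norm u = 1" "u \<in> orth K F"
    using cod.normalize_unit[OF False] cod.orth_antimono[of F "range Y"] y
      cod.vs.subspace_scale[OF cod.subspace_orth] unfolding u_def by blast+
  then have "u \<notin> F" using cod.in_orth_self[of u F] by auto
  then have "(norm (adj H K T u))\<^sup>2 \<le> 0"
    using trace_maximal[OF F, of "insert u F"] assms(4) F(1) cod.orthonormal_insert[OF F(2) u] by simp
  then have "adj H K T u = 0" by simp
  then show ?thesis using False by (simp add: u_def adj.smult)
qed (simp add: adj.zero)

lemma adj_Y_eq:
  assumes F: "finite F" "orthonormal K F" "cod.vs.span F = range Y"
  shows "adj H K Y = adj H K T \<circ> cod.fproj F"
proof (rule Y.adj_eqI)
  fix x y
  have sub: "cod.vs.subspace (cod.vs.span F)" and cl: "closed (cod.vs.span F)"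
    using cod.closed_span_orthonormal[OF F(1,2)] by auto
  have proj: "proj K (cod.vs.span F) z = cod.fproj F z" for z
    using cod.fproj_in_span cod.diff_fproj_orth[OF F(1,2)]
    by (intro cod.proj_eqI sub) (auto simp: cod.orth_span)
  have "ip K (Y x) y = ip K (cod.fproj F (T x)) y" by (simp add: fun_cong[OF Y_eq_fproj[OF F]])
  also have "\<dots> = ip K (T x) (cod.fproj F y)"
    using cod.ip_proj_commute[OF sub cl, of "T x" y] by (simp add: proj)
  finally show "ip K (Y x) y = ip H x ((adj H K T \<circ> cod.fproj F) y)" by (simp add: ip_adj)
qed

theorem adj_truncated_svd: "is_truncated_svd K H r (adj H K T) (adj H K Y)"
proof -
  obtain F where F: "finite F" "orthonormal K F" "cod.vs.span F = range Y"
    using cod.ex_orthonormal_basis[OF Y.subspace_range] fin_range by metis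
  have card: "card F \<le> r" using cod.dim_span_orthonormal[OF F(1,2)] dim_le by (simp add: F(3))
  interpret adj': hilbert_schmidt_operator K H "adj H K T"
    by unfold_locales (rule hilbert_schmidt_adj[OF hilbert_schmidt])
  have orth: "orth K F = orth K (range Y)" using cod.orth_span[of F] by (simp add: F(3))
  show ?thesis
    unfolding adj_Y_eq[OF F]
    by (rule adj'.truncated_svd_fproj[OF F(1,2) card])
      (use ip_adj_range_orth norm_adj_le adj_orth_eq_0[OF F] in \<open>auto simp: orth F(3)\<close>)
qed

text \<open>The range \<open>R\<close> of \<open>Y\<close> is invariant under \<open>T T\<^sup>*\<close>, and \<open>Y\<close> maps \<open>range Y\<^sup>* = T\<^sup>* R\<close> onto \<open>R\<close>.\<close>

lemma range_subset: "range Y \<subseteq> range T"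
proof
  fix y assume "y \<in> range Y"
  then obtain x where y: "y = Y x" by blast
  obtain F where F: "finite F" "orthonormal K F" "cod.vs.span F = range Y"
    using cod.ex_orthonormal_basis[OF Y.subspace_range] fin_range by metis
  have sub: "cod.vs.subspace (cod.vs.span F)" and cl: "closed (cod.vs.span F)"
    using cod.closed_span_orthonormal[OF F(1,2)] by auto
  obtain h h' where h: "h \<in> orth H (ker_op Y)" "Y x = Y h" using Y.ker_decomp[of x] by metis
  have "cod.fproj F ` UNIV = cod.vs.span F"
  proof
    show "cod.vs.span F \<subseteq> range (cod.fproj F)"
      using cod.fproj_id[OF F(1,2)] by (metis rangeI subsetI)
  qed (use cod.fproj_in_span in blast)
  then have rng: "range (adj H K Y) = adj H K T ` cod.vs.span F"
    unfolding adj_Y_eq[OF F] by (metis image_comp)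
  then have rng': "range (adj H K Y) = dom.vs.span (adj H K T ` F)"
    by (simp add: adj.span_image)
  obtain G where "finite G" "orthonormal H G" "dom.vs.span G = dom.vs.span (adj H K T ` F)"
    using dom.gram_schmidt[of "adj H K T ` F" "{}"] F(1) by auto
  \<comment> \<open>\<open>orth_ker\<close> only places \<open>h\<close> in the closure of this
    range; finite dimension makes it an actual adjoint image.\<close>
  then have "closed (range (adj H K Y))"
    using dom.closed_span_orthonormal rng' by metis
  then have "h \<in> range (adj H K Y)" using h(1) by (simp add: Y.orth_ker)
  then obtain z where z: "z \<in> cod.vs.span F" "h = adj H K T z" using rng by blast
  have "T h \<in> orth K (orth K (cod.vs.span F))"
    using ip_adj_range_orth[of z] z by (auto simp: orth_def[of K "orth K _"] F(3) ip_adj)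
  then have "T h \<in> cod.vs.span F" using cod.orth_orth_closed[OF sub cl] by simp
  then have "Y h = T h" by (simp add: fun_cong[OF Y_eq_fproj[OF F]] cod.fproj_id[OF F(1,2)])
  then show "y \<in> range T" using y h(2) by simp
qed

end

section \<open>Boundedness of operators induced on the range\<close>

text \<open>The equivalence of (i) to (iv) uses only these properties of \<open>Xhat\<close>; finite
  rank of \<open>Z\<close> enters solely in \<open>bound_of_closed_image\<close>.\<close>

locale induced_operator = C: bounded_operator H1 H2 C + Z: bounded_operator H1 H3 Z
  for H1 :: "('k::rc_scalar, 'a::banach) hilbert"
    and H2 :: "('k, 'b::banach) hilbert"
    and H3 :: "('k, 'c::banach) hilbert" and C Z +
  fixes X :: "'b \<Rightarrow> 'c"
  assumes ker_subset: "ker_op C \<subseteq> ker_op Z"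
    and X_eq: "k \<in> orth H2 (range C) \<Longrightarrow> X (C h + k) = Z h"
begin

lemma X_C: "X (C h) = Z h"
  using X_eq[of 0 h] C.cod.vs.subspace_0[OF C.cod.subspace_orth] by simp

text \<open>Links (ii) and (iii). Passing to the complement of \<open>ker_op C\<close> loses
  nothing, as the discarded component is killed by \<open>C\<close> and by \<open>Z\<close>.\<close>

lemma ker_X_range: "ker_on (mp_dom H2 C) X \<inter> range C = C ` (ker_op Z \<inter> orth H1 (ker_op C))"
proof (intro equalityI subsetI)
  fix y assume "y \<in> ker_on (mp_dom H2 C) X \<inter> range C"
  then obtain x where x: "y = C x" "Z x = 0" using X_C by (auto simp: ker_on_def)
  obtain h h' where h: "x = h + h'" "h \<in> orth H1 (ker_op C)" "h' \<in> ker_op C" "C x = C h"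
    using C.ker_decomp[of x] by metis
  then have "Z h = 0" using x(2) ker_subset by (auto simp: Z.add ker_op_def)
  then show "y \<in> C ` (ker_op Z \<inter> orth H1 (ker_op C))" using h x by (auto simp: ker_op_def)
next
  fix y assume "y \<in> C ` (ker_op Z \<inter> orth H1 (ker_op C))"
  then show "y \<in> ker_on (mp_dom H2 C) X \<inter> range C"
    using X_C C.range_subset_mp_dom by (auto simp: ker_on_def ker_op_def)
qed

text \<open>A component orthogonal to \<open>range C\<close> leaves the value of \<open>X\<close>
  unchanged and can only enlarge the norm of the argument.\<close>

lemma bounded_iff: "bounded_op_on (mp_dom H2 C) X \<longleftrightarrow> (\<exists>\<eta>>0. \<forall>h. norm (Z h) \<le> \<eta> * norm (C h))"
proof
  assume "bounded_op_on (mp_dom H2 C) X"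
  then obtain c where c: "\<And>y. y \<in> mp_dom H2 C \<Longrightarrow> norm (X y) \<le> c * norm y"
    by (auto simp: bounded_op_on_def)
  have "norm (Z h) \<le> (\<bar>c\<bar> + 1) * norm (C h)" for h
  proof -
    have "norm (Z h) \<le> c * norm (C h)"
      using c[of "C h"] C.range_subset_mp_dom by (auto simp: X_C)
    also have "\<dots> \<le> (\<bar>c\<bar> + 1) * norm (C h)" by (intro mult_right_mono) auto
    finally show ?thesis .
  qed
  then show "\<exists>\<eta>>0. \<forall>h. norm (Z h) \<le> \<eta> * norm (C h)" by (intro exI[of _ "\<bar>c\<bar> + 1"]) auto
next
  assume "\<exists>\<eta>>0. \<forall>h. norm (Z h) \<le> \<eta> * norm (C h)"
  then obtain \<eta> where \<eta>: "\<eta> > 0" "\<And>h. norm (Z h) \<le> \<eta> * norm (C h)" by blast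
  show "bounded_op_on (mp_dom H2 C) X"
    unfolding bounded_op_on_def
  proof (intro exI ballI)
    fix y assume "y \<in> mp_dom H2 C"
    then obtain h k where y: "y = C h + k" "k \<in> orth H2 (range C)" by (auto simp: mp_dom_def)
    have "ip H2 (C h) k = 0" using C.cod.orthD'[OF y(2)] by blast
    from C.cod.pythagoras[OF this] have "(norm (C h))\<^sup>2 \<le> (norm y)\<^sup>2" by (simp add: y)
    then have "norm (C h) \<le> norm y" by (rule power2_le_imp_le) simp
    then have "\<eta> * norm (C h) \<le> \<eta> * norm y" using \<eta>(1) by simp
    then show "norm (X y) \<le> \<eta> * norm y" using \<eta>(2)[of h] X_eq[OF y(2)] y(1) by simp
  qed
qed

lemma closed_ker_of_bounded:
  assumes "bounded_op_on (mp_dom H2 C) X"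
  shows "closedin (top_of_set (mp_dom H2 C)) (ker_on (mp_dom H2 C) X)"
  unfolding closedin_closed
proof (intro exI[of _ "closure (ker_on (mp_dom H2 C) X)"] conjI closed_closure equalityI)
  obtain c where c: "\<And>y. y \<in> mp_dom H2 C \<Longrightarrow> norm (X y) \<le> c * norm y"
    using assms by (auto simp: bounded_op_on_def)
  \<comment> \<open>Linearity of \<open>X\<close> on its domain is inherited from \<open>Z\<close>
    through \<open>X_eq\<close>.\<close>
  have X_diff: "X (y - z) = X y - X z" if "y \<in> mp_dom H2 C" "z \<in> mp_dom H2 C" for y z
  proof -
    from that obtain h k h' k' where y: "y = C h + k" "k \<in> orth H2 (range C)"
      and z: "z = C h' + k'" "k' \<in> orth H2 (range C)" unfolding mp_dom_def by blast
    have eq: "y - z = C (h - h') + (k - k')" by (simp add: y z C.diff)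
    show ?thesis
      unfolding eq using X_eq[OF C.cod.vs.subspace_diff[OF C.cod.subspace_orth y(2) z(2)], of "h - h'"]
        X_eq[OF y(2)] X_eq[OF z(2)] by (simp add: y(1) z(1) Z.diff)
  qed
  show "mp_dom H2 C \<inter> closure (ker_on (mp_dom H2 C) X) \<subseteq> ker_on (mp_dom H2 C) X"
  proof
    fix y assume y: "y \<in> mp_dom H2 C \<inter> closure (ker_on (mp_dom H2 C) X)"
    then have "y \<in> closure (ker_on (mp_dom H2 C) X)" by blast
    then obtain z where z: "\<And>n. z n \<in> ker_on (mp_dom H2 C) X" "z \<longlonglongrightarrow> y"
      unfolding closure_sequential by blast
    have "norm (X y) \<le> c * norm (y - z n)" for n
    proof -
      have zn: "z n \<in> mp_dom H2 C" "X (z n) = 0" using z(1)[of n] by (auto simp: ker_on_def)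
      have "y - z n \<in> mp_dom H2 C"
        using y zn C.cod.vs.subspace_diff[OF C.subspace_mp_dom] by blast
      from c[OF this] show ?thesis using X_diff[of y "z n"] y zn by simp
    qed
    moreover have "(\<lambda>n. c * norm (y - z n)) \<longlonglongrightarrow> c * norm (y - y)"
      by (intro tendsto_intros z(2))
    ultimately have "norm (X y) \<le> c * norm (y - y)"
      by (intro LIMSEQ_le_const) auto
    then show "y \<in> ker_on (mp_dom H2 C) X" using y by (simp add: ker_on_def)
  qed
qed (use closure_subset[of "ker_on (mp_dom H2 C) X"] in \<open>auto simp: ker_on_def\<close>)

lemma closed_image_of_closed_ker:
  assumes "closedin (top_of_set (mp_dom H2 C)) (ker_on (mp_dom H2 C) X)"
  shows "closedin (top_of_set (range C)) (C ` (ker_op Z \<inter> orth H1 (ker_op C)))"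
proof -
  obtain S where "closed S" "ker_on (mp_dom H2 C) X = mp_dom H2 C \<inter> S"
    using assms unfolding closedin_closed by blast
  then have "C ` (ker_op Z \<inter> orth H1 (ker_op C)) = range C \<inter> S"
    using ker_X_range C.range_subset_mp_dom by blast
  then show ?thesis unfolding closedin_closed using \<open>closed S\<close> by blast
qed

text \<open>Let \<open>Q\<close> be the projection onto the orthogonal complement of \<open>V = closure (C (ker Z))\<close>.  Since
  \<open>Q C h\<close> is a linear function of \<open>Z h\<close>, the range of \<open>Q C\<close> has a finite orthonormal basis
  \<open>u\<^sub>j = Q C h\<^sub>j\<close>; closedness says that conversely \<open>Z\<close> vanishes on the kernel of \<open>Q C\<close>.  Hence
  \<open>Z h = (\<Sum>j. \<langle>Q C h, u\<^sub>j\<rangle> Z h\<^sub>j)\<close>.\<close>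

lemma bound_of_closed_image:
  assumes fin: "finite b" "range Z \<subseteq> module.span (smult H3) b"
    and cl: "closedin (top_of_set (range C)) (C ` (ker_op Z \<inter> orth H1 (ker_op C)))"
  shows "\<exists>\<eta>>0. \<forall>h. norm (Z h) \<le> \<eta> * norm (C h)"
proof -
  define W where "W = C ` (ker_op Z \<inter> orth H1 (ker_op C))"
  define V where "V = closure W"
  have sW: "C.cod.vs.subspace W"
    unfolding W_def
    by (intro C.subspace_image C.dom.vs.subspace_inter Z.subspace_ker C.dom.subspace_orth)
  have V: "C.cod.vs.subspace V" "closed V"
    unfolding V_def by (rule C.cod.subspace_closure[OF sW], rule closed_closure)
  obtain S where S: "closed S" "W = range C \<inter> S" using cl unfolding W_def closedin_closed by blast
  \<comment> \<open>Relative closedness means that passing from \<open>W\<close> to its closure adds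
    no points of \<open>range C\<close>.\<close>
  have "V \<subseteq> S" unfolding V_def using S by (intro closure_minimal) auto
  then have V_range: "x \<in> W" if "x \<in> V" "x \<in> range C" for x
    using that S(2) by blast
  define Q where "Q x = x - proj H2 V x" for x
  have Q_add: "Q (x + y) = Q x + Q y" and Q_smult: "Q (smult H2 a x) = smult H2 a (Q x)" for a x y
    using V by (simp_all add: Q_def C.cod.proj_add C.cod.proj_smult C.cod.vs.scale_right_diff_distrib)
  have Q_norm: "norm (Q x) \<le> norm x" for x
    unfolding Q_def using C.cod.norm_proj[OF V, of x] by (intro power2_le_imp_le[OF _ norm_ge_zero]) simp
  have Q_0: "Q x = 0 \<longleftrightarrow> x \<in> V" for x
  proof
    assume "x \<in> V"
    then have "proj H2 V x = x"
      using V C.cod.vs.subspace_0[OF C.cod.subspace_orth] by (intro C.cod.proj_eqI) auto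
    then show "Q x = 0" by (simp add: Q_def)
  next
    assume "Q x = 0"
    then have "x = proj H2 V x" by (simp add: Q_def)
    then show "x \<in> V" using C.cod.proj_in[OF V] by metis
  qed
  have "bounded_operator H2 H2 Q"
    by unfold_locales (rule bounded_opsI[where c = 1],
      auto simp: Q_add Q_smult Q_norm intro: C.cod.hilbert_space_axioms)
  then have "Q \<circ> C \<in> bounded_ops H1 H2"
    using bounded_ops_comp C.bounded_operator_axioms by blast
  then interpret QC: bounded_operator H1 H2 "Q \<circ> C" by unfold_locales
  have ker: "(Q \<circ> C) h = 0 \<longleftrightarrow> Z h = 0" for h
  proof -
    have "(Q \<circ> C) h = 0 \<longleftrightarrow> C h \<in> W"
      using Q_0 V_range closure_subset[of W] by (auto simp: V_def)
    also have "\<dots> \<longleftrightarrow> Z h = 0"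
      unfolding W_def ker_X_range[symmetric] ker_on_def using X_C C.range_subset_mp_dom by auto
    finally show ?thesis .
  qed
  \<comment> \<open>Finitely many preimages \<open>G\<close> of a spanning set of
    \<open>range Z\<close> suffice: by \<open>ker\<close>, equal values of \<open>Z\<close> force
    equal values of \<open>Q \<circ> C\<close>, so the images of \<open>G\<close> span its
    range.\<close>
  obtain A where A: "finite A" "Z.cod.vs.span A = range Z"
    using Z.cod.ex_orthonormal_basis[OF Z.subspace_range fin(2,1)] by metis
  then obtain G where G: "finite G" "A = Z ` G"
    using finite_subset_image[of A Z UNIV] Z.cod.vs.span_superset[of A] by auto
  have "range (Q \<circ> C) \<subseteq> C.cod.vs.span ((Q \<circ> C) ` G)"
  proof (rule image_subsetI)
    fix h
    have "Z h \<in> Z ` C.dom.vs.span G" using A(2) G(2) Z.span_image[of G] by blast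
    then obtain g where g: "g \<in> C.dom.vs.span G" "Z h = Z g" by blast
    then have "(Q \<circ> C) (h - g) = 0" using ker by (simp add: Z.diff)
    then have "(Q \<circ> C) h = (Q \<circ> C) g" unfolding QC.diff by simp
    then show "(Q \<circ> C) h \<in> C.cod.vs.span ((Q \<circ> C) ` G)"
      using g(1) QC.span_image[of G] by blast
  qed
  then obtain F where F: "finite F" "orthonormal H2 F" "C.cod.vs.span F = range (Q \<circ> C)"
    using C.cod.ex_orthonormal_basis[OF QC.subspace_range _ finite_imageI[OF G(1)]] by metis
  then have "\<forall>u\<in>F. \<exists>h. u = (Q \<circ> C) h" using C.cod.vs.span_superset[of F] by blast
  then obtain p where p: "\<And>u. u \<in> F \<Longrightarrow> u = (Q \<circ> C) (p u)" by metis
  have "norm (Z h) \<le> ((\<Sum>u\<in>F. norm (Z (p u))) + 1) * norm (C h)" for h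
  proof -
    let ?h' = "\<Sum>u\<in>F. smult H1 (ip H2 (Q (C h)) u) (p u)"
    have "(Q \<circ> C) ?h' = C.cod.fproj F (Q (C h))"
      unfolding QC.sum QC.smult C.cod.fproj_def using p by (intro sum.cong) auto
    also have "\<dots> = Q (C h)"
      using F(3) by (intro C.cod.fproj_id[OF F(1,2)]) auto
    finally have "(Q \<circ> C) (h - ?h') = 0" unfolding QC.diff by simp
    then have "Z h = (\<Sum>u\<in>F. smult H3 (ip H2 (Q (C h)) u) (Z (p u)))"
      unfolding ker Z.diff Z.sum Z.smult by simp
    also have "norm \<dots> \<le> (\<Sum>u\<in>F. norm (C h) * norm (Z (p u)))"
    proof (intro sum_norm_le)
      fix u assume "u \<in> F"
      have "norm (ip H2 (Q (C h)) u) \<le> norm (C h)"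
        using C.cod.cauchy_schwarz[of "Q (C h)" u] C.cod.orthonormal_norm[OF F(2) \<open>u \<in> F\<close>]
          Q_norm[of "C h"] by simp
      then show "norm (smult H3 (ip H2 (Q (C h)) u) (Z (p u))) \<le> norm (C h) * norm (Z (p u))"
        by (simp add: Z.cod.norm_smult mult_right_mono)
    qed
    also have "\<dots> \<le> ((\<Sum>u\<in>F. norm (Z (p u))) + 1) * norm (C h)"
      by (simp add: algebra_simps sum_distrib_left)
    finally show ?thesis .
  qed
  moreover have "(\<Sum>u\<in>F. norm (Z (p u))) + 1 > 0" by (simp add: add_nonneg_pos sum_nonneg)
  ultimately show ?thesis by blast
qed

end

section \<open>Compositions with projectors, and the equivalence\<close>

lemma bounded_ops_sum_rank_one:
  assumes "hilbert_space H" "hilbert_space K" "finite F"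
  shows "(\<lambda>x. \<Sum>f\<in>F. smult K (ip H x (u f)) (w f)) \<in> bounded_ops H K"
proof -
  interpret H: hilbert_space H by fact
  interpret K: hilbert_space K by fact
  show ?thesis
  proof (rule bounded_opsI[OF assms(1,2), where c = "\<Sum>f\<in>F. norm (u f) * norm (w f)"])
    fix x
    have "norm (\<Sum>f\<in>F. smult K (ip H x (u f)) (w f)) \<le> (\<Sum>f\<in>F. norm x * (norm (u f) * norm (w f)))"
      by (intro sum_norm_le) (simp add: K.norm_smult mult_right_mono H.cauchy_schwarz flip: mult.assoc)
    then show "norm (\<Sum>f\<in>F. smult K (ip H x (u f)) (w f)) \<le> (\<Sum>f\<in>F. norm (u f) * norm (w f)) * norm x"
      by (simp add: sum_distrib_left mult.commute)
  qed (simp_all add: H.ip_simps K.vs.scale_left_distrib sum.distrib K.vs.scale_sum_right)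
qed

lemma adj_proj_comp_proj:
  assumes "bounded_operator H K M"
    and V: "module.subspace (smult H) V" "closed V" and W: "module.subspace (smult K) W" "closed W"
  shows "adj H K (proj K W \<circ> M \<circ> proj H V) = proj H V \<circ> adj H K M \<circ> proj K W"
    and "proj K W \<circ> M \<circ> proj H V \<in> bounded_ops H K"
proof -
  interpret M: bounded_operator H K M by fact
  have PV: "bounded_operator H H (proj H V)" and PW: "bounded_operator K K (proj K W)"
    using M.dom.bounded_ops_proj[OF V] M.cod.bounded_ops_proj[OF W] by unfold_locales auto
  have "bounded_operator H K (proj K W \<circ> M)"
    using bounded_ops_comp[OF assms(1) PW] by unfold_locales
  then show B: "proj K W \<circ> M \<circ> proj H V \<in> bounded_ops H K"
    by (rule bounded_ops_comp[OF PV])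
  interpret P: bounded_operator H K "proj K W \<circ> M \<circ> proj H V" using B by unfold_locales
  show "adj H K (proj K W \<circ> M \<circ> proj H V) = proj H V \<circ> adj H K M \<circ> proj K W"
    by (rule P.adj_eqI) (simp add: M.cod.ip_proj_commute[OF W] M.dom.ip_proj_commute[OF V] M.ip_adj)
qed

lemma hilbert_schmidt_proj_comp:
  assumes "hilbert_space K" "hilbert_schmidt H K T" "module.subspace (smult K) W" "closed W"
  shows "hilbert_schmidt H K (proj K W \<circ> T)"
proof -
  interpret K: hilbert_space K by fact
  have "(\<Sum>f\<in>F. (norm ((proj K W \<circ> T) f))\<^sup>2) \<le> (\<Sum>f\<in>F. (norm (T f))\<^sup>2)" for F
    by (intro sum_mono power_mono) (simp_all add: K.norm_proj_le assms)
  then show ?thesis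
    using assms(2) unfolding hilbert_schmidt_def by (meson order_trans)
qed

text \<open>A projector on the right does not preserve orthonormal sets; taking adjoints moves it to
  the left, where it only decreases norms.\<close>

lemma hilbert_schmidt_comp_proj:
  assumes "hilbert_schmidt_operator H K M" "module.subspace (smult H) V" "closed V"
  shows "hilbert_schmidt H K (M \<circ> proj H V)"
proof -
  interpret M: hilbert_schmidt_operator H K M by fact
  have PV: "bounded_operator H H (proj H V)"
    using M.dom.bounded_ops_proj[OF assms(2,3)] by unfold_locales
  interpret P: bounded_operator H K "M \<circ> proj H V"
    using bounded_ops_comp[OF PV M.bounded_operator_axioms] by unfold_locales
  have "adj H K (M \<circ> proj H V) = proj H V \<circ> adj H K M"
    by (rule P.adj_eqI) (simp add: M.ip_adj M.dom.ip_proj_commute[OF assms(2,3)])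
  then have "hilbert_schmidt K H (adj H K (M \<circ> proj H V))"
    using hilbert_schmidt_proj_comp[OF M.dom.hilbert_space_axioms
        M.hilbert_schmidt_adj[OF M.hilbert_schmidt] assms(2,3)] by simp
  then show ?thesis using P.adj.hilbert_schmidt_adj by simp
qed

theorem proposition5p2:
  fixes H1 :: "('k::rc_scalar, 'a::banach) hilbert"
    and H2 :: "('k, 'b::banach) hilbert"
    and H3 :: "('k, 'c::banach) hilbert"
    and H4 :: "('k, 'd::banach) hilbert"
    and r :: nat
    and M K Kr :: "'a \<Rightarrow> 'd"
    and B :: "'c \<Rightarrow> 'd"
    and C :: "'a \<Rightarrow> 'b"
    and Xhat :: "'b \<Rightarrow> 'c"
    and Z :: "'a \<Rightarrow> 'c"
    and Kstar :: "'d \<Rightarrow> 'a"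
  assumes "separable_hilbert_space H1" "separable_hilbert_space H2"
    and "separable_hilbert_space H3" "separable_hilbert_space H4"
    and "M \<in> hs_ops H1 H4"
    and "B \<in> bounded_ops H3 H4"
    and "C \<in> bounded_ops H1 H2"
    and "K = proj H4 (closure (range B)) \<circ> M \<circ> proj H1 (orth H1 (ker_op C))"
    and "best_approx_set H1 H4 r B K \<noteq> {}"
    and "Kr \<in> best_approx_set H1 H4 r B K"
    and "Xhat = mp_inv H3 H4 B \<circ> Kr \<circ> mp_inv H1 H2 C"
    and "Z = mp_inv H3 H4 B \<circ> Kr"
    and "Kstar = proj H1 (closure (range (adj H1 H2 C))) \<circ> adj H1 H4 M \<circ>
                 proj H4 (orth H4 (ker_op (adj H3 H4 B)))"
  defines "i \<equiv> bounded_op_on (mp_dom H2 C) Xhat"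
    and "ii \<equiv> closedin (top_of_set (mp_dom H2 C)) (ker_on (mp_dom H2 C) Xhat)"
    and "iii \<equiv> closedin (top_of_set (range C)) (C ` (ker_op Z \<inter> orth H1 (ker_op C)))"
    and "iv \<equiv> \<exists>\<eta>>0. \<forall>h. norm (Z h) \<le> \<eta> * norm (C h)"
    and "v \<equiv> range (adj H1 H4 Kr) \<subseteq> mp_dom H1 (adj H1 H2 C)"
  shows "Kstar = adj H1 H4 K \<and> is_truncated_svd H4 H1 r Kstar (adj H1 H4 Kr) \<and>
         (i \<longleftrightarrow> ii) \<and> (i \<longleftrightarrow> iii) \<and> (i \<longleftrightarrow> iv) \<and> (i \<longleftrightarrow> v)"
proof -
  interpret H1: hilbert_space H1 using assms(1) by (rule separable_hilbert_space.axioms)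
  interpret H2: hilbert_space H2 using assms(2) by (rule separable_hilbert_space.axioms)
  interpret H3: hilbert_space H3 using assms(3) by (rule separable_hilbert_space.axioms)
  interpret H4: hilbert_space H4 using assms(4) by (rule separable_hilbert_space.axioms)
  interpret M: hilbert_schmidt_operator H1 H4 M
    by (rule hs_ops_hilbert_schmidt) (use assms in \<open>auto intro: H1.hilbert_space_axioms H4.hilbert_space_axioms\<close>)
  interpret B: bounded_operator H3 H4 B by unfold_locales fact
  interpret C: bounded_operator H1 H2 C by unfold_locales fact
  have sV: "H1.vs.subspace (orth H1 (ker_op C))" and cV: "closed (orth H1 (ker_op C))"
    by (rule H1.subspace_orth, rule H1.closed_orth)
  have sW: "H4.vs.subspace (closure (range B))" and cW: "closed (closure (range B))"
    by (rule H4.subspace_closure[OF B.subspace_range], rule closed_closure)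
  note adjK = adj_proj_comp_proj[OF M.bounded_operator_axioms sV cV sW cW, folded assms(8)]
  interpret K: hilbert_schmidt_operator H1 H4 K
  proof unfold_locales
    show "hilbert_schmidt H1 H4 K"
      unfolding assms(8) comp_assoc
      by (intro hilbert_schmidt_proj_comp[OF H4.hilbert_space_axioms _ sW cW]
          hilbert_schmidt_comp_proj[OF M.hilbert_schmidt_operator_axioms sV cV])
  qed (rule adjK(2))
  interpret best_approximation H1 H4 K Kr r
    using assms(10) by unfold_locales (auto simp: best_approx_set_def)
  have Kr_dom: "range Kr \<subseteq> mp_dom H4 B" using assms(10) by (simp add: best_approx_set_def)
  \<comment> \<open>By \<open>orth_ker\<close> for \<open>C\<close> and for the adjoint of
    \<open>B\<close>, the two descriptions of each projector's subspace coincide.\<close>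
  have "Kstar = adj H1 H4 K"
    unfolding adjK(1) assms(13) C.orth_ker B.adj.orth_ker ..
  have K_range: "range K \<subseteq> closure (range B)"
    using H4.proj_in[OF sW cW] by (auto simp: assms(8))
  \<comment> \<open>In general \<open>B\<close> after its Moore-Penrose inverse returns only the
    component in \<open>range B\<close>; nothing is lost here because \<open>range_subset\<close>
    puts \<open>Kr x\<close> in the closure of \<open>range B\<close>.\<close>
  have B_Z: "B (Z x) = Kr x" for x
  proof -
    have "Kr x \<in> mp_dom H4 B" "Kr x \<in> closure (range B)"
      using Kr_dom range_subset K_range by blast+
    from B.mp_dom_closure_range(2)[OF this] show ?thesis by (simp add: assms(12))
  qed
  obtain F where F: "finite F" "orthonormal H4 F" "H4.vs.span F = range Kr"
    using H4.ex_orthonormal_basis[OF Y.subspace_range] fin_range by metis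
  have "K x = 0" if "C x = 0" for x
  proof -
    have "x \<in> orth H1 (orth H1 (ker_op C))"
      using that H1.orth_iff_subset[of "ker_op C" "orth H1 (ker_op C)"] by (auto simp: ker_op_def)
    then have "proj H1 (orth H1 (ker_op C)) x = 0"
      by (intro H1.proj_eqI sV) (auto simp: H1.vs.subspace_0[OF sV])
    moreover have "proj H4 (closure (range B)) 0 = 0"
      using H4.vs.subspace_0[OF sW] H4.vs.subspace_0[OF H4.subspace_orth]
      by (intro H4.proj_eqI sW) auto
    ultimately show ?thesis by (simp add: assms(8) M.zero)
  qed
  then have Kr_ker: "Kr x = 0" if "C x = 0" for x
    using that fun_cong[OF Y_eq_fproj[OF F], of x] by (simp add: H4.fproj_def)
  have B_inv_0: "mp_inv H3 H4 B 0 = 0"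
    using B.mp_inv_eq[of 0 0] H3.vs.subspace_0[OF H3.subspace_orth] H4.vs.subspace_0[OF H4.subspace_orth]
    by (simp add: B.zero)
  have F_dom: "f \<in> mp_dom H4 B" if "f \<in> F" for f
    using H4.vs.span_superset[of F] Kr_dom that by (auto simp: F(3))
  \<comment> \<open>The inverse is linear only on its domain, so the induction has to carry
    membership along.\<close>
  have mp_sum: "mp_inv H3 H4 B (\<Sum>f\<in>G. smult H4 (a f) f) = (\<Sum>f\<in>G. smult H3 (a f) (mp_inv H3 H4 B f))
      \<and> (\<Sum>f\<in>G. smult H4 (a f) f) \<in> mp_dom H4 B" if "finite G" "G \<subseteq> F" for a G
    using that
  proof (induction G rule: finite_induct)
    case empty
    then show ?case using B.subspace_mp_dom by (simp add: B_inv_0 H4.vs.subspace_0)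
  next
    case (insert g G)
    have "g \<in> mp_dom H4 B" using insert F_dom by blast
    moreover from this have "smult H4 (a g) g \<in> mp_dom H4 B"
      by (rule H4.vs.subspace_scale[OF B.subspace_mp_dom])
    ultimately show ?case
      using insert by (simp add: B.mp_inv_add B.mp_inv_smult H4.vs.subspace_add[OF B.subspace_mp_dom])
  qed
  \<comment> \<open>Only finitely many values of the possibly unbounded inverse of \<open>B\<close>
    occur, which makes \<open>Z\<close> bounded and of finite rank.\<close>
  have Z_eq: "Z x = (\<Sum>f\<in>F. smult H3 (ip H1 x (adj H1 H4 Kr f)) (mp_inv H3 H4 B f))" for x
  proof -
    have "Z x = mp_inv H3 H4 B (H4.fproj F (Kr x))"
      using H4.fproj_id[OF F(1,2), of "Kr x"] by (simp add: F(3) assms(12))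
    also have "\<dots> = (\<Sum>f\<in>F. smult H3 (ip H4 (Kr x) f) (mp_inv H3 H4 B f))"
      unfolding H4.fproj_def using mp_sum[OF F(1) subset_refl] by blast
    finally show ?thesis by (simp add: Y.ip_adj)
  qed
  then have "Z \<in> bounded_ops H1 H3"
    using bounded_ops_sum_rank_one[OF H1.hilbert_space_axioms H3.hilbert_space_axioms F(1),
        of "adj H1 H4 Kr" "mp_inv H3 H4 B"] by (simp flip: Z_eq)
  then interpret Z: bounded_operator H1 H3 Z by unfold_locales
  have Z_fin: "range Z \<subseteq> H3.vs.span (mp_inv H3 H4 B ` F)"
    unfolding Z_eq by (intro image_subsetI H3.vs.span_sum H3.vs.span_scale H3.vs.span_base) auto
  interpret induced_operator H1 H2 H3 C Z Xhat
  proof unfold_locales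
    show ker: "ker_op C \<subseteq> ker_op Z" using Kr_ker by (auto simp: ker_op_def assms(12) B_inv_0)
    fix h k assume k: "k \<in> orth H2 (range C)"
    obtain h' h'' where h: "h = h' + h''" "h' \<in> orth H1 (ker_op C)" "h'' \<in> ker_op C" "C h = C h'"
      using C.ker_decomp[of h] by metis
    have "Xhat (C h + k) = Z h'"
      using C.mp_inv_eq[OF h(2) k] by (simp add: assms(11,12) h(4))
    also have "\<dots> = Z h" using h(3) ker by (auto simp: h(1) Z.add ker_op_def)
    finally show "Xhat (C h + k) = Z h" .
  qed
  have iv_v: v if iv
  proof -
    from that obtain \<eta> where \<eta>: "\<And>h. norm (Z h) \<le> \<eta> * norm (C h)" by (auto simp: iv_def)
    obtain c where c: "c \<ge> 0" "\<And>x. norm (B x) \<le> c * norm x" using B.ex_bound by blast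
    have "adj H1 H4 Kr y \<in> range (adj H1 H2 C)" for y
    proof -
      have "\<exists>w. \<forall>x. ip H4 (Kr x) y = ip H2 (C x) w"
      proof (rule C.functional_factors)
        fix x
        have "norm (Kr x) \<le> c * norm (Z x)" using c(2)[of "Z x"] by (simp add: B_Z)
        also have "\<dots> \<le> c * (\<eta> * norm (C x))" by (intro mult_left_mono \<eta> c(1))
        finally have "norm (Kr x) * norm y \<le> c * (\<eta> * norm (C x)) * norm y"
          by (rule mult_right_mono) simp
        then show "norm (ip H4 (Kr x) y) \<le> (c * \<eta> * norm y) * norm (C x)"
          using H4.cauchy_schwarz[of "Kr x" y] by (simp add: mult_ac)
      qed (simp_all add: Y.add Y.smult H4.ip_simps)
      then obtain w where w: "\<And>x. ip H4 (Kr x) y = ip H2 (C x) w" by blast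
      have "adj H1 H4 Kr y = adj H1 H2 C w"
      proof (rule H1.eqI_ip)
        show "ip H1 (adj H1 H4 Kr y) z = ip H1 (adj H1 H2 C w) z" for z
          using w[of z] H4.ip_scnj[of y "Kr z"] H2.ip_scnj[of w "C z"]
          by (simp add: Y.ip_adj' C.ip_adj')
      qed
      then show ?thesis by blast
    qed
    then show v unfolding v_def using C.adj.range_subset_mp_dom by blast
  qed
  \<comment> \<open>As \<open>Kr\<close> vanishes on \<open>ker_op C\<close>, the vectors
    \<open>adj H1 H4 Kr f\<close> lie in the closure of the range of the adjoint of
    \<open>C\<close>; with the domain condition they lie in that range. The coefficients in
    \<open>Z_eq\<close> thus become \<open>ip H2 (C h) (w f)\<close>, bounded by
    \<open>norm (C h)\<close>.\<close>
  have v_iv: iv if v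
  proof -
    have "\<exists>w. adj H1 H4 Kr f = adj H1 H2 C w" for f
    proof -
      have "adj H1 H4 Kr f \<in> orth H1 (ker_op C)"
        using Kr_ker by (auto simp: orth_def Y.ip_adj' ker_op_def)
      then have "adj H1 H4 Kr f \<in> closure (range (adj H1 H2 C))" by (simp add: C.orth_ker)
      moreover have "adj H1 H4 Kr f \<in> mp_dom H1 (adj H1 H2 C)" using that by (auto simp: v_def)
      ultimately show ?thesis using C.adj.mp_dom_closure_range(1) by blast
    qed
    then obtain w where w: "\<And>f. adj H1 H4 Kr f = adj H1 H2 C (w f)" by metis
    define \<eta> where "\<eta> = (\<Sum>f\<in>F. norm (w f) * norm (mp_inv H3 H4 B f)) + 1"
    have "norm (Z h) \<le> \<eta> * norm (C h)" for h
    proof -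
      have "norm (Z h) \<le> (\<Sum>f\<in>F. norm (C h) * (norm (w f) * norm (mp_inv H3 H4 B f)))"
        unfolding Z_eq
        by (intro sum_norm_le)
          (simp add: w H3.norm_smult mult_right_mono H2.cauchy_schwarz flip: mult.assoc C.ip_adj)
      also have "\<dots> \<le> \<eta> * norm (C h)" by (simp add: \<eta>_def sum_distrib_left algebra_simps)
      finally show ?thesis .
    qed
    moreover have "\<eta> > 0" by (simp add: \<eta>_def add_nonneg_pos sum_nonneg)
    ultimately show iv unfolding iv_def by blast
  qed
  have "i \<longleftrightarrow> iv" unfolding i_def iv_def by (rule bounded_iff)
  moreover have ii if i using that closed_ker_of_bounded by (simp add: i_def ii_def)
  moreover have iii if ii using that closed_image_of_closed_ker by (simp add: ii_def iii_def)
  moreover have iv if iii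
    using that bound_of_closed_image[OF _ Z_fin] F(1) by (simp add: iii_def iv_def)
  ultimately show ?thesis
    using iv_v v_iv \<open>Kstar = adj H1 H4 K\<close> adj_truncated_svd by blast
qed

end
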